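(* Each $\mathbb Z[t]$-basis element (basic cycle) of $PH_*(\mathrm{config}(n,* );\mathbb Z)$ born at $w=w_0$ either persists for all $w>w_0$ or dies by $w=2w_0$. For each $j$ and $w_0$, either the inclusion-induced maps $$H_j(\mathrm{config}(n,w_0);\mathbb Z)\to H_j(\mathrm{config}(n,w);\mathbb Z)$$ are isomorphisms for all $w>w_0$ and all $n$, or the fraction of basis elements (basic cycles) of $H_j(\mathrm{config}(n,w_0);\mathbb Z)$ that persist to $H_j(\mathrm{config}(n,w_0+1);\mathbb Z)$ approaches $0$ as $n$ approaches $\infty$.
   Context: $\mathrm{config}(n,w)$ is the space of configurations of $n$ pairwise non-overlapping disks of diameter $1$, labeled $1,\dots,n$, in the strip $\mathbb R\times[0,w]$, $w\ge1$ an integer. $PH_*(\mathrm{config}(n,* );\mathbb Z)=\bigoplus_{w}H_*(\mathrm{config}(n,w);\mathbb Z)$ is a $\mathbb Z[t]$-module, $t$ acting by the maps induced by $\mathrm{config}(n,w)\subset\mathrm{config}(n,w+1)$. Cell model. A symbol on a finite set $A$ is a sequence of nonempty blocks $b_1\mid\cdots\mid b_m$, each an ordered list, each element of $A$ occurring exactly once. $\mathrm{cel}(A)$ has one $(|A|-m)$-cell for each symbol; codimension-one faces are obtained by replacing a block by two consecutive blocks $a\mid b$ of which it is a shuffle. $\mathrm{cel}(n,w)\subset\mathrm{cel}(n)=\mathrm{cel}(\{1,\dots,n\})$ consists of cells whose blocks have at most $w$ elements; $\mathrm{cel}(n,w)\simeq\mathrm{config}(n,w)$ compatibly with inclusions in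 $w$. Boundary: for a one-block symbol $g$, the coefficient of $a\mid b$ in $\partial g$ is $(-1)^{\mathrm{length}(a)}$ times the sign of the permutation taking the list $g$ to $ab$; $\partial(g_1\mid g_2)=\partial g_1\mid g_2+(-1)^{\dim g_1}g_1\mid\partial g_2$, where $\mid$ is concatenation with a bar. Juxtaposition of linear combinations of one-block symbols concatenates lists inside one block, bilinearly. Wheel: $W(a_1)=a_1$, $W(a_1,\dots,a_k)=W(a_1,\dots,a_{k-1})a_k+(-1)^ka_kW(a_1,\dots,a_{k-1})$, a $(k-1)$-cycle, allowed when $k\le w$. Filter: for $r\ge2$ ordered wheels $W_1,\dots,W_r$ on disjoint label sets with $k>w$ disks in total, each having at least $k-w$ disks, the $(k-2)$-cycle $\partial(W_1\cdots W_r)$ of $\mathrm{cel}(\cdot,w)$. One wheel ranks above another if it has more disks, or the same number of disks and larger largest label. A basic cycle of $\mathrm{config}(n,w)$ is a concatenation $c_1\mid\cdots\mid c_m$ of wheels and filters with label sets partitioning $\{1,\dots,n\}$ such that (i) each wheel has its largest label first; (ii) wheels inside each filter are in ascending order by largest label; (iii) adjacent wheels not inside a filter are ordered from higher to lower rank; (iv) every wheel immediately to the left of a filter ranks above the lowest-ranking wheel in the filter. For each $w$ the basic cycles represent a $\mathbb Z$-basis of $H_*(\mathrm{config}(n,w))$, and over all $w$ they give a decomposition of $PH_*$ into cyclic $\mathbb Z[t]$-modules. A basic cycle is born at the smallest $w$ for which it is a basic cycle of $\mathrm{config}(n,w)$, dies at the smallest later $w$ at which its homology class is zero, and persists to $w'$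 if its class in $H_*(\mathrm{config}(n,w'))$ is nonzero. *)

theory Defs
  imports "HOL-Homology.Homology" "HOL-Combinatorics.Combinatorics"
begin

text \<open>Configurations of \<open>n\<close> labeled disks of diameter 1 in the strip of width \<open>w\<close>. A configuration
  is given by the centers of the disks; non-overlapping means that the open disks are disjoint,
  so tangent disks are allowed.\<close>

definition config :: "nat \<Rightarrow> nat \<Rightarrow> (nat \<Rightarrow> real \<times> real) topology" where
  "config n w = subtopology (product_topology (\<lambda>_. euclidean) {1..n})
     {p. (\<forall>i\<in>{1..n}. cball (p i) (1/2) \<subseteq> UNIV \<times> {0..real w}) \<and>
         (\<forall>i\<in>{1..n}. \<forall>j\<in>{1..n}. i \<noteq> j \<longrightarrow> ball (p i) (1/2) \<inter> ball (p j) (1/2) = {})}"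

abbreviation config_homology ::
    "nat \<Rightarrow> nat \<Rightarrow> nat \<Rightarrow> (nat \<Rightarrow> real \<times> real) chain set monoid" where
  "config_homology n w j \<equiv> homology_group (int j) (config n w)"

text \<open>The action of \<open>t\<close> to the power \<open>w' - w\<close> on the width \<open>w\<close> summand of the persistent homology:
  the map on singular homology induced by the inclusion of \<open>config n w\<close> in \<open>config n w'\<close>.\<close>

definition stab ::
    "nat \<Rightarrow> nat \<Rightarrow> nat \<Rightarrow> nat \<Rightarrow> (nat \<Rightarrow> real \<times> real) chain set \<Rightarrow> (nat \<Rightarrow> real \<times> real) chain set" where
  "stab n w w' j = hom_induced (int j) (config n w) {} (config n w') {} id"

type_synonym symbol = "nat list list"
type_synonym cel_chain = "symbol \<Rightarrow>\<^sub>0 int"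

definition cells :: "nat \<Rightarrow> nat \<Rightarrow> nat \<Rightarrow> symbol set" where
  "cells n w d = {s. [] \<notin> set s \<and> distinct (concat s) \<and> set (concat s) = {1..n} \<and>
                     (\<forall>b\<in>set s. length b \<le> w) \<and> length s + d = n}"

definition bar :: "cel_chain \<Rightarrow> cel_chain \<Rightarrow> cel_chain" where
  "bar x y = frag_extend (\<lambda>s. frag_extend (\<lambda>t. frag_of (s @ t)) y) x"

definition rearrangement_sign :: "nat list \<Rightarrow> nat list \<Rightarrow> int" where
  "rearrangement_sign g h = sign (THE p. p permutes set g \<and> map p g = h)"

definition block_boundary :: "nat list \<Rightarrow> cel_chain" where
  "block_boundary g =
     (\<Sum>(a, b) | a \<noteq> [] \<and> b \<noteq> [] \<and> g \<in> shuffles a b.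
        frag_cmul ((-1) ^ length a * rearrangement_sign g (a @ b)) (frag_of [a, b]))"

fun symbol_boundary :: "symbol \<Rightarrow> cel_chain" where
  "symbol_boundary [] = 0"
| "symbol_boundary (g # s) =
     bar (block_boundary g) (frag_of s) +
     frag_cmul ((-1) ^ (length g - 1)) (bar (frag_of [g]) (symbol_boundary s))"

definition cel_boundary :: "cel_chain \<Rightarrow> cel_chain" where
  "cel_boundary = frag_extend symbol_boundary"

definition cel_cycles :: "nat \<Rightarrow> nat \<Rightarrow> nat \<Rightarrow> cel_chain set" where
  "cel_cycles n w d = {z \<in> carrier (free_Abelian_group (cells n w d)). cel_boundary z = 0}"

definition cel_boundaries :: "nat \<Rightarrow> nat \<Rightarrow> nat \<Rightarrow> cel_chain set" where
  "cel_boundaries n w d = cel_boundary ` carrier (free_Abelian_group (cells n w (Suc d)))"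

definition cel_homology :: "nat \<Rightarrow> nat \<Rightarrow> nat \<Rightarrow> cel_chain set monoid" where
  "cel_homology n w d =
     subgroup_generated (free_Abelian_group (cells n w d)) (cel_cycles n w d)
       Mod cel_boundaries n w d"

definition cel_class :: "nat \<Rightarrow> nat \<Rightarrow> nat \<Rightarrow> cel_chain \<Rightarrow> cel_chain set" where
  "cel_class n w d z = cel_boundaries n w d #>\<^bsub>free_Abelian_group (cells n w d)\<^esub> z"

text \<open>Linear combinations of one-block symbols are represented by linear combinations of lists,
  which \<open>as_block\<close> turns into chains.\<close>

definition juxt :: "(nat list \<Rightarrow>\<^sub>0 int) \<Rightarrow> (nat list \<Rightarrow>\<^sub>0 int) \<Rightarrow> (nat list \<Rightarrow>\<^sub>0 int)" where
  "juxt x y = frag_extend (\<lambda>a. frag_extend (\<lambda>b. frag_of (a @ b)) y) x"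

definition as_block :: "(nat list \<Rightarrow>\<^sub>0 int) \<Rightarrow> cel_chain" where
  "as_block = frag_extend (\<lambda>b. frag_of [b])"

text \<open>The recursion for wheels removes the last label, so it runs over the reversed list. The
  value on the empty list is never used.\<close>

fun wheel_rev :: "nat list \<Rightarrow> (nat list \<Rightarrow>\<^sub>0 int)" where
  "wheel_rev [] = 0"
| "wheel_rev [a] = frag_of [a]"
| "wheel_rev (a # b # bs) =
     juxt (wheel_rev (b # bs)) (frag_of [a]) +
     frag_cmul ((-1) ^ length (a # b # bs)) (juxt (frag_of [a]) (wheel_rev (b # bs)))"

definition wheel :: "nat list \<Rightarrow> (nat list \<Rightarrow>\<^sub>0 int)" where
  "wheel as = wheel_rev (rev as)"

text \<open>A basic cycle is represented by the formal concatenation that describes it: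
  \<open>Wheel [a\<^sub>1, \<dots>, a\<^sub>k]\<close> stands for the wheel on these labels, and \<open>Filter [v\<^sub>1, \<dots>, v\<^sub>r]\<close> for the
  filter on the wheels with label lists \<open>v\<^sub>1, \<dots>, v\<^sub>r\<close>.\<close>

datatype component = Wheel "nat list" | Filter "nat list list"

fun comp_chain :: "component \<Rightarrow> cel_chain" where
  "comp_chain (Wheel as) = as_block (wheel as)"
| "comp_chain (Filter ws) = cel_boundary (as_block (foldr juxt (map wheel ws) (frag_of [])))"

definition cycle_chain :: "component list \<Rightarrow> cel_chain" where
  "cycle_chain c = foldr bar (map comp_chain c) (frag_of [])"

fun comp_wheels :: "component \<Rightarrow> nat list list" where
  "comp_wheels (Wheel as) = [as]"
| "comp_wheels (Filter ws) = ws"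

fun comp_dim :: "component \<Rightarrow> nat" where
  "comp_dim (Wheel as) = length as - 1"
| "comp_dim (Filter ws) = length (concat ws) - 2"

definition cycle_dim :: "component list \<Rightarrow> nat" where
  "cycle_dim c = sum_list (map comp_dim c)"

fun comp_allowed :: "nat \<Rightarrow> component \<Rightarrow> bool" where
  "comp_allowed w (Wheel as) \<longleftrightarrow> as \<noteq> [] \<and> length as \<le> w"
| "comp_allowed w (Filter ws) \<longleftrightarrow>
     length ws \<ge> 2 \<and> [] \<notin> set ws \<and> length (concat ws) > w \<and>
     (\<forall>v\<in>set ws. length v \<ge> length (concat ws) - w)"

definition largest :: "nat list \<Rightarrow> nat" where
  "largest as = Max (set as)"

definition ranks_above :: "nat list \<Rightarrow> nat list \<Rightarrow> bool" where
  "ranks_above a b \<longleftrightarrow> length a > length b \<or> (length a = length b \<and> largest a > largest b)"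

definition lowest_ranking :: "nat list \<Rightarrow> nat list list \<Rightarrow> bool" where
  "lowest_ranking v ws \<longleftrightarrow> v \<in> set ws \<and> (\<forall>u\<in>set ws. u \<noteq> v \<longrightarrow> ranks_above u v)"

fun adjacent_ok :: "component \<Rightarrow> component \<Rightarrow> bool" where
  "adjacent_ok (Wheel a) (Wheel b) \<longleftrightarrow> ranks_above a b"
| "adjacent_ok (Wheel a) (Filter ws) \<longleftrightarrow> (\<exists>v. lowest_ranking v ws \<and> ranks_above a v)"
| "adjacent_ok (Filter ws) _ \<longleftrightarrow> True"

definition basic_cycle :: "nat \<Rightarrow> nat \<Rightarrow> component list \<Rightarrow> bool" where
  "basic_cycle n w c \<longleftrightarrow>
     w \<ge> 1 \<and>
     distinct (concat (concat (map comp_wheels c))) \<and>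
     set (concat (concat (map comp_wheels c))) = {1..n} \<and>
     (\<forall>x\<in>set c. comp_allowed w x) \<and>
     (\<forall>x\<in>set c. \<forall>v\<in>set (comp_wheels x). hd v = largest v) \<and>
     (\<forall>ws. Filter ws \<in> set c \<longrightarrow> sorted_wrt (\<lambda>u v. largest u < largest v) ws) \<and>
     (\<forall>i. Suc i < length c \<longrightarrow> adjacent_ok (c ! i) (c ! Suc i))"

definition basic_cycles :: "nat \<Rightarrow> nat \<Rightarrow> nat \<Rightarrow> component list set" where
  "basic_cycles n w j = {c. basic_cycle n w c \<and> cycle_dim c = j}"

definition born_at :: "nat \<Rightarrow> component list \<Rightarrow> nat \<Rightarrow> bool" where
  "born_at n c w \<longleftrightarrow> basic_cycle n w c \<and> (\<forall>v<w. \<not> basic_cycle n v c)"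

type_synonym identification =
  "nat \<Rightarrow> nat \<Rightarrow> nat \<Rightarrow> cel_chain set \<Rightarrow> (nat \<Rightarrow> real \<times> real) chain set"

text \<open>The homology equivalence between the cell complexes and the configuration spaces, compatible
  with the inclusions in \<open>w\<close>. It is what gives a cellular cycle a class in the homology of
  \<open>config n w\<close>. A chain of the smaller complex is literally a chain of the larger one, so the map
  of cellular homology induced by inclusion sends the class of \<open>z\<close> to the class of \<open>z\<close>.\<close>

definition cellular_identification :: "identification \<Rightarrow> bool" where
  "cellular_identification \<Phi> \<longleftrightarrow>
     (\<forall>n w j. 1 \<le> w \<longrightarrow> \<Phi> n w j \<in> iso (cel_homology n w j) (config_homology n w j)) \<and>
     (\<forall>n w w' j. \<forall>z\<in>cel_cycles n w j. 1 \<le> w \<longrightarrow> w \<le> w' \<longrightarrow>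
        stab n w w' j (\<Phi> n w j (cel_class n w j z)) = \<Phi> n w' j (cel_class n w' j z))"

definition config_class ::
    "identification \<Rightarrow> nat \<Rightarrow> component list \<Rightarrow> nat \<Rightarrow> (nat \<Rightarrow> real \<times> real) chain set" where
  "config_class \<Phi> n c w = \<Phi> n w (cycle_dim c) (cel_class n w (cycle_dim c) (cycle_chain c))"

definition persists :: "identification \<Rightarrow> nat \<Rightarrow> component list \<Rightarrow> nat \<Rightarrow> nat \<Rightarrow> bool" where
  "persists \<Phi> n c w w' \<longleftrightarrow>
     stab n w w' (cycle_dim c) (config_class \<Phi> n c w) \<noteq> \<one>\<^bsub>config_homology n w' (cycle_dim c)\<^esub>"

definition dies_at :: "identification \<Rightarrow> nat \<Rightarrow> component list \<Rightarrow> nat \<Rightarrow> bool" where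
  "dies_at \<Phi> n c d \<longleftrightarrow>
     (\<exists>w\<^sub>0<d. born_at n c w\<^sub>0 \<and> \<not> persists \<Phi> n c w\<^sub>0 d \<and>
        (\<forall>w. w\<^sub>0 < w \<and> w < d \<longrightarrow> persists \<Phi> n c w\<^sub>0 w))"

end

theory Submission
  imports Defs "HOL-Real_Asymp.Real_Asymp"
begin

text \<open>Every wheel is an iterated commutator of odd generators, hence primitive for the unshuffle
  coproduct that defines the boundary. So wheels are cycles, and the boundary of a product of wheels
  splits it only between whole wheels; a filter on \<open>k\<close> disks therefore has width at most \<open>w\<close>,
  and it becomes a boundary at width \<open>k \<le> 2 w\<close>. A concatenation of wheels never becomes a
  boundary: the graded symmetric cochain that detects its blocks is a cocycle and takes the value
  \<open>\<plusminus>1\<close> on it.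

  If \<open>j + 2 \<le> w\<close>, the cell complexes of widths \<open>w\<close> and more agree in the dimensions that matter for
  \<open>H\<^sub>j\<close>. Otherwise a basic cycle that survives to width \<open>w + 1\<close> has no filter on \<open>w + 1\<close>
  disks. All its filters then consist of wheels with at least two disks, so all single disks stand at
  the end in a forced order and there are only polynomially many such cycles in \<open>n\<close>. But a single
  filter on the disks \<open>1, \<dots>, w + 1\<close> already lets all other single disks choose a side, which gives
  exponentially many basic cycles.\<close>

text \<open>Two gradings govern the signs. Under juxtaposition every label has degree one, which
  makes the wheel recursion a graded commutator; under the bar a block of length k has degree k - 1,
  the dimension of its cell. The set along which a list is unshuffled stays fixed: labels are
  distinct, so each set selects one component of the coproduct, and vanishing can be checked set by
  set.

  The homology equivalence enters only through bijectivity and naturality, so persistence to width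
  w' becomes the question whether \<open>cycle_chain c\<close> lies in \<open>cel_boundaries\<close>
  at width w'. The exact death of a cycle with filters is not computed: a filter on k disks only
  bounds by k the first width at which the class vanishes.

  In the count, j is fixed while n grows. A component of dimension d has at most d + 2 disks, so the
  degree of the polynomial bound depends on j alone. For the exponential family, the filter on w + 1
  disks has dimension only w - 1; wheels on two disks supply the missing j + 1 - w, which needs w at
  least 2. For w = 1 and j > 0 there are no basic cycles at all.\<close>

lemma frag_cmul_diff: "frag_cmul c (x - y) = frag_cmul c x - frag_cmul c y"
  using frag_cmul_distrib2[of c "x - y" y] by (simp add: eq_diff_eq)

lemma keys_addE:
  assumes "t \<in> Poly_Mapping.keys (x + y)"
  obtains "t \<in> Poly_Mapping.keys x" | "t \<in> Poly_Mapping.keys y"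
  using assms Poly_Mapping.keys_add[of x y] by blast

text \<open>The bilinear extension of list concatenation. It is both \<open>bar\<close>, on lists of
  blocks, and \<open>juxt\<close>, on lists of labels, so the algebra of the two products is
  developed once.\<close>

definition frag_append :: "('a list \<Rightarrow>\<^sub>0 int) \<Rightarrow> ('a list \<Rightarrow>\<^sub>0 int) \<Rightarrow> ('a list \<Rightarrow>\<^sub>0 int)" (infixr "\<odot>" 70)
  where "x \<odot> y = frag_extend (\<lambda>s. frag_extend (\<lambda>t. frag_of (s @ t)) y) x"

lemma bar_eq: "bar = (\<odot>)"
  by (intro ext) (simp add: bar_def frag_append_def)

lemma juxt_eq: "juxt = (\<odot>)"
  by (intro ext) (simp add: juxt_def frag_append_def)

lemma frag_extend_add_fun:
  "frag_extend (\<lambda>s. f s + g s) x = frag_extend f x + frag_extend g x"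
  by (simp add: frag_extend_def frag_cmul_distrib2 sum.distrib)

lemma frag_extend_cmul_fun:
  "frag_extend (\<lambda>s. frag_cmul k (f s)) x = frag_cmul k (frag_extend f x)"
  by (simp add: frag_extend_def frag_cmul_sum mult.commute)

lemma frag_extend_sum_fun:
  "frag_extend (\<lambda>s. \<Sum>i\<in>I. f i s) x = (\<Sum>i\<in>I. frag_extend (f i) x)"
  unfolding frag_extend_def by (simp add: frag_cmul_sum) (rule sum.swap)

lemma frag_extend_diff_fun:
  "frag_extend (\<lambda>s. f s - g s) x = frag_extend f x - frag_extend g x"
  using frag_extend_add_fun[of "\<lambda>s. f s - g s" g x] by simp

lemma frag_append_of [simp]: "frag_of s \<odot> frag_of t = frag_of (s @ t)"
  by (simp add: frag_append_def)

lemma frag_append_zero [simp]: "0 \<odot> y = 0" "x \<odot> 0 = 0"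
  by (simp_all add: frag_append_def frag_extend_eq_0)

lemma frag_append_add:
  "(x + x') \<odot> y = x \<odot> y + x' \<odot> y" "x \<odot> (y + y') = x \<odot> y + x \<odot> y'"
  by (simp_all add: frag_append_def frag_extend_add frag_extend_add_fun)

lemma frag_append_diff:
  "(x - x') \<odot> y = x \<odot> y - x' \<odot> y" "x \<odot> (y - y') = x \<odot> y - x \<odot> y'"
  by (simp_all add: frag_append_def frag_extend_diff frag_extend_diff_fun)

lemma frag_append_cmul [simp]:
  "frag_cmul k x \<odot> y = frag_cmul k (x \<odot> y)" "x \<odot> frag_cmul k y = frag_cmul k (x \<odot> y)"
  by (simp_all add: frag_append_def frag_extend_cmul frag_extend_cmul_fun)

lemma frag_append_sum_left: "finite I \<Longrightarrow> (\<Sum>i\<in>I. f i) \<odot> y = (\<Sum>i\<in>I. f i \<odot> y)"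
  by (simp add: frag_append_def frag_extend_sum)

lemma frag_append_Nil [simp]: "frag_of [] \<odot> y = y" "x \<odot> frag_of [] = x"
  by (simp_all add: frag_append_def flip: frag_expansion)

lemma frag_append_assoc: "(x \<odot> y) \<odot> z = x \<odot> y \<odot> z"
proof (rule frag_induction[where S = UNIV and c = x and P = "\<lambda>x. (x \<odot> y) \<odot> z = x \<odot> y \<odot> z"])
  fix a
  show "(frag_of a \<odot> y) \<odot> z = frag_of a \<odot> y \<odot> z"
  proof (rule frag_induction[where S = UNIV and c = y and P = "\<lambda>y. (frag_of a \<odot> y) \<odot> z = frag_of a \<odot> y \<odot> z"])
    fix b
    show "(frag_of a \<odot> frag_of b) \<odot> z = frag_of a \<odot> frag_of b \<odot> z"
      by (rule frag_induction[where S = UNIV and c = z]) (simp_all add: frag_append_diff)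
  qed (simp_all add: frag_append_diff)
qed (simp_all add: frag_append_diff)

lemma keys_frag_extendE:
  assumes "t \<in> Poly_Mapping.keys (frag_extend f x)"
  obtains s where "s \<in> Poly_Mapping.keys x" "t \<in> Poly_Mapping.keys (f s)"
  using assms keys_frag_extend by fastforce

lemma keys_frag_appendE:
  assumes "u \<in> Poly_Mapping.keys (x \<odot> y)"
  obtains s t where "s \<in> Poly_Mapping.keys x" "t \<in> Poly_Mapping.keys y" "u = s @ t"
  using assms unfolding frag_append_def
  by (elim keys_frag_extendE) (auto simp: keys_frag_of)

lemma keys_sumE:
  assumes "t \<in> Poly_Mapping.keys (\<Sum>i\<in>I. f i)"
  obtains i where "i \<in> I" "t \<in> Poly_Mapping.keys (f i)"
  using assms keys_sum by fastforce

section \<open>Unshuffling along a set\<close>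

abbreviation elems_in :: "'a set \<Rightarrow> 'a list \<Rightarrow> 'a list"
  where "elems_in A \<equiv> filter (\<lambda>x. x \<in> A)"

abbreviation elems_out :: "'a set \<Rightarrow> 'a list \<Rightarrow> 'a list"
  where "elems_out A \<equiv> filter (\<lambda>x. x \<notin> A)"

text \<open>The number of transpositions of neighbours that move the members of A in front of the
  others: the exponent of the Koszul sign of an unshuffle.\<close>

fun crossings :: "'a set \<Rightarrow> 'a list \<Rightarrow> nat" where
  "crossings A [] = 0"
| "crossings A (x # g) = crossings A g + (if x \<in> A then 0 else length (elems_in A g))"

lemma crossings_append:
  "crossings A (g @ h) = crossings A g + crossings A h + length (elems_out A g) * length (elems_in A h)"
  by (induction g) auto

lemma crossings_cong: "A \<inter> set g = B \<inter> set g \<Longrightarrow> crossings A g = crossings B g"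
proof (induction g)
  case (Cons x g)
  moreover from Cons.prems have "A \<inter> set g = B \<inter> set g" by auto
  moreover from Cons.prems have "elems_in A g = elems_in B g" "x \<in> A \<longleftrightarrow> x \<in> B"
    by (auto intro!: filter_cong)
  ultimately show ?case by simp
qed simp

lemma crossings_subset: "set g \<subseteq> A \<Longrightarrow> crossings A g = 0"
  by (induction g) auto

lemma crossings_disjoint: "set g \<inter> A = {} \<Longrightarrow> crossings A g = 0"
  by (induction g) (auto simp: filter_empty_conv)

text \<open>Every pair of a member and a non-member of A is a crossing for exactly one of A and its
  complement.\<close>

lemma crossings_complement:
  "crossings A g + crossings (- A) g = length (elems_in A g) * length (elems_out A g)"
  by (induction g) auto

text \<open>This is the coassociativity behind \<open>\<partial>\<partial> = 0\<close>.\<close>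

lemma crossings_coassoc:
  "B \<inter> C = {} \<Longrightarrow>
    crossings (B \<union> C) g + crossings B (elems_in (B \<union> C) g) = crossings B g + crossings C (elems_out B g)"
proof (induction g)
  case (Cons x g)
  have "length (elems_in (B \<union> C) g) = length (elems_in B g) + length (elems_in C g)"
    using Cons.prems by (induction g) auto
  moreover have "elems_in B (elems_in (B \<union> C) g) = elems_in B g" "elems_in C (elems_out B g) = elems_in C g"
    using Cons.prems by (auto intro!: filter_cong)
  ultimately show ?case
    using Cons by auto
qed simp

section \<open>Signs of rearrangements of distinct lists\<close>

lemma rearrangement_witness:
  assumes "distinct g" "mset g = mset h"
  shows "\<exists>!p. p permutes set g \<and> map p g = h"
proof -
  have "distinct h" using assms by (metis mset_eq_imp_distinct_iff)
  have len: "length g = length h" using assms(2) by (metis size_mset)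
  define p where "p = (\<lambda>x. if x \<in> set g then the (map_of (zip g h) x) else x)"
  have map: "map p g = h"
  proof (rule nth_equalityI)
    fix i assume "i < length (map p g)"
    then show "map p g ! i = h ! i"
      using \<open>distinct g\<close> len by (simp add: p_def map_of_zip_nth)
  qed (simp add: len)
  have "set h = set g" using assms(2) by (metis mset_eq_setD)
  then have "bij_betw p (set g) (set g)"
    using map \<open>distinct h\<close> by (metis bij_betw_def distinct_map list.set_map)
  then have perm: "p permutes set g"
    by (rule bij_imp_permutes) (simp add: p_def)
  show ?thesis
  proof (intro ex1I conjI)
    fix q assume q: "q permutes set g \<and> map q g = h"
    show "q = p"
    proof
      fix x show "q x = p x"
      proof (cases "x \<in> set g")
        case True
        then show ?thesis using q map by (metis map_eq_conv)
      next
        case False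
        then show ?thesis using q perm by (metis permutes_not_in)
      qed
    qed
  qed (fact perm map)+
qed

lemma rearrangement_sign_eq:
  assumes "distinct g" "p permutes set g" "map p g = h"
  shows "rearrangement_sign g h = sign p"
proof -
  have "mset g = mset h"
    using assms by (metis mset_map mset_set_set permutes_image_mset)
  then have "(THE q. q permutes set g \<and> map q g = h) = p"
    using assms by (intro the1_equality[OF rearrangement_witness]) simp_all
  then show ?thesis
    by (simp add: rearrangement_sign_def)
qed

lemma rearrangementE:
  assumes "distinct g" "mset g = mset h"
  obtains p where "p permutes set g" "map p g = h" "rearrangement_sign g h = sign p"
  using rearrangement_witness[OF assms] rearrangement_sign_eq[OF assms(1)] by metis

text \<open>The permutations act on entries rather than positions, so rearranging twice composes
  them, and \<open>sign\<close> is multiplicative.\<close>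

lemma rearrangement_sign_trans:
  assumes "distinct g" "mset g = mset h" "mset h = mset k"
  shows "rearrangement_sign g k = rearrangement_sign g h * rearrangement_sign h k"
proof -
  obtain p where p: "p permutes set g" "map p g = h" "rearrangement_sign g h = sign p"
    using assms rearrangementE by blast
  have h: "distinct h" "set h = set g"
    using assms by (metis mset_eq_imp_distinct_iff mset_eq_setD)+
  obtain q where q: "q permutes set g" "map q h = k" "rearrangement_sign h k = sign q"
    using assms h rearrangementE by metis
  have "rearrangement_sign g k = sign (q \<circ> p)"
    using assms p q by (intro rearrangement_sign_eq) (auto intro: permutes_compose)
  also have "\<dots> = sign q * sign p"
    using p q by (intro sign_compose) (auto intro: permutes_imp_permutation)
  finally show ?thesis using p q by simp
qed

lemma rearrangement_sign_refl: "distinct g \<Longrightarrow> rearrangement_sign g g = 1"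
  using rearrangement_sign_eq[of g id g] by (simp add: permutes_id)

lemma rearrangement_sign_Cons:
  assumes "distinct (x # g)" "mset g = mset h"
  shows "rearrangement_sign (x # g) (x # h) = rearrangement_sign g h"
proof -
  obtain p where p: "p permutes set g" "map p g = h" "rearrangement_sign g h = sign p"
    using assms rearrangementE by (metis distinct.simps(2))
  have "p permutes set (x # g)"
    using p(1) by (rule permutes_subset) auto
  moreover have "p x = x" using p(1) assms(1) by (simp add: permutes_not_in)
  ultimately show ?thesis
    using rearrangement_sign_eq[of "x # g" p "x # h"] assms p by simp
qed

lemma rearrangement_sign_swap:
  assumes "distinct (x # y # g)"
  shows "rearrangement_sign (x # y # g) (y # x # g) = -1"
proof -
  have "map (Transposition.transpose x y) g = g"
    using assms by (intro map_idI) (auto simp: Transposition.transpose_def)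
  then have "rearrangement_sign (x # y # g) (y # x # g) = sign (Transposition.transpose x y)"
    using assms by (intro rearrangement_sign_eq) (auto intro: permutes_swap_id)
  also have "\<dots> = -1" using assms by (simp add: sign_swap_id)
  finally show ?thesis .
qed

lemma rearrangement_sign_move:
  "distinct (x # a @ b) \<Longrightarrow> rearrangement_sign (x # a @ b) (a @ x # b) = (-1) ^ length a"
proof (induction a)
  case (Cons y a)
  have "rearrangement_sign (x # y # a @ b) (y # a @ x # b)
      = rearrangement_sign (x # y # a @ b) (y # x # a @ b) *
        rearrangement_sign (y # x # a @ b) (y # a @ x # b)"
    using Cons.prems by (intro rearrangement_sign_trans) auto
  also have "rearrangement_sign (y # x # a @ b) (y # a @ x # b) = (-1) ^ length a"
    using Cons by (subst rearrangement_sign_Cons) auto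
  finally show ?case using Cons.prems by (simp add: rearrangement_sign_swap)
qed (simp add: rearrangement_sign_refl)

lemma mset_elems_in_out: "mset (elems_in A g @ elems_out A g) = mset g"
  by (induction g) auto

lemma rearrangement_sign_unshuffle:
  "distinct g \<Longrightarrow> rearrangement_sign g (elems_in A g @ elems_out A g) = (-1) ^ crossings A g"
proof (induction g)
  case (Cons x g)
  let ?a = "elems_in A g" and ?b = "elems_out A g"
  have d: "distinct (x # ?a @ ?b)"
    using Cons.prems mset_elems_in_out[of A g] by auto
  have step: "rearrangement_sign (x # g) (x # ?a @ ?b) = (-1) ^ crossings A g"
    using Cons rearrangement_sign_Cons[of x g "?a @ ?b"] mset_elems_in_out[of A g] by simp
  show ?case
  proof (cases "x \<in> A")
    case False
    have "rearrangement_sign (x # g) (?a @ x # ?b)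
        = rearrangement_sign (x # g) (x # ?a @ ?b) * rearrangement_sign (x # ?a @ ?b) (?a @ x # ?b)"
      using Cons.prems mset_elems_in_out[of A g] by (intro rearrangement_sign_trans) auto
    with False step rearrangement_sign_move[OF d] show ?thesis by (simp add: power_add)
  qed (use step in simp)
qed (simp add: rearrangement_sign_refl)

definition proper_subsets :: "'a set \<Rightarrow> 'a set set"
  where "proper_subsets L = Pow L - {{}, L}"

lemma finite_proper_subsets [simp]: "finite L \<Longrightarrow> finite (proper_subsets L)"
  by (simp add: proper_subsets_def)

text \<open>For a list of distinct labels, a way to write it as a shuffle of a and b is determined
  by \<open>set a\<close>. The sum over pairs of lists thus becomes a sum over sets, with a sign
  that counts crossings.\<close>

lemma block_boundary_unshuffle:
  assumes "distinct g"
  shows "block_boundary g = (\<Sum>A\<in>proper_subsets (set g).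
    frag_cmul ((-1) ^ (card A + crossings A g)) (frag_of [elems_in A g, elems_out A g]))"
proof -
  let ?S = "{(a, b). a \<noteq> [] \<and> b \<noteq> [] \<and> g \<in> shuffles a b}"
  have S: "set a \<in> proper_subsets (set g)" "elems_in (set a) g = a" "elems_out (set a) g = b"
    "(-1) ^ length a * rearrangement_sign g (a @ b) = (-1) ^ (card (set a) + crossings (set a) g)"
    if ab: "(a, b) \<in> ?S" for a b
  proof -
    from ab have p: "a \<noteq> []" "b \<noteq> []" "g \<in> shuffles a b" by simp_all
    have "distinct (a @ b)"
      using mset_shuffles[OF p(3)] assms by (metis mset_eq_imp_distinct_iff mset_append)
    then have d: "set a \<inter> set b = {}" "distinct a" by simp_all
    show io: "elems_in (set a) g = a" "elems_out (set a) g = b"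
      using filter_shuffles_disjoint1[OF d(1) p(3)] by simp_all
    have "set a \<noteq> set a \<union> set b" using p(2) d(1) by (cases b) auto
    then have "set a \<in> proper_subsets (set a \<union> set b)"
      using p(1) by (simp add: proper_subsets_def)
    then show "set a \<in> proper_subsets (set g)"
      by (simp add: set_shuffles[OF p(3)])
    have 1: "rearrangement_sign g (a @ b) = (-1) ^ crossings (set a) g"
      using rearrangement_sign_unshuffle[OF assms, of "set a"] unfolding io .
    have 2: "card (set a) = length a"
      by (rule distinct_card[OF d(2)])
    show "(-1) ^ length a * rearrangement_sign g (a @ b) = (-1) ^ (card (set a) + crossings (set a) g)"
      unfolding 1 2 power_add ..
  qed
  have T: "(elems_in A g, elems_out A g) \<in> ?S" "set (elems_in A g) = A" if A: "A \<in> proper_subsets (set g)" for A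
  proof -
    from A have "elems_in A g \<noteq> []" "elems_out A g \<noteq> []"
      by (auto simp: proper_subsets_def filter_empty_conv)
    then show "(elems_in A g, elems_out A g) \<in> ?S"
      using partition_in_shuffles[of g "\<lambda>x. x \<in> A"] by simp
    from A show "set (elems_in A g) = A" unfolding proper_subsets_def by auto
  qed
  have "bij_betw (\<lambda>A. (elems_in A g, elems_out A g)) (proper_subsets (set g)) ?S"
  proof (rule bij_betw_byWitness[where f' = "\<lambda>(a, b). set a"])
    show "\<forall>A\<in>proper_subsets (set g). (case (elems_in A g, elems_out A g) of (a, b) \<Rightarrow> set a) = A"
      using T(2) by simp
    show "\<forall>p\<in>?S. (elems_in (case p of (a, b) \<Rightarrow> set a) g, elems_out (case p of (a, b) \<Rightarrow> set a) g) = p"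
      using S(2,3) by fastforce
    show "(\<lambda>A. (elems_in A g, elems_out A g)) ` proper_subsets (set g) \<subseteq> ?S"
      using T(1) by (rule image_subsetI)
    show "(\<lambda>(a, b). set a) ` ?S \<subseteq> proper_subsets (set g)"
      using S(1) by fastforce
  qed
  then have "block_boundary g = (\<Sum>A\<in>proper_subsets (set g).
      case (elems_in A g, elems_out A g) of (a, b) \<Rightarrow>
        frag_cmul ((-1) ^ length a * rearrangement_sign g (a @ b)) (frag_of [a, b]))"
    unfolding block_boundary_def by (rule sum.reindex_bij_betw[symmetric])
  also have "\<dots> = (\<Sum>A\<in>proper_subsets (set g).
      frag_cmul ((-1) ^ (card A + crossings A g)) (frag_of [elems_in A g, elems_out A g]))"
    using S(4)[OF T(1)] T(2) by (intro sum.cong) simp_all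
  finally show ?thesis .
qed

section \<open>The unshuffle coproduct and its vanishing on wheels\<close>

definition unshuffle :: "'a set \<Rightarrow> ('a list \<Rightarrow>\<^sub>0 int) \<Rightarrow> ('a list \<times> 'a list \<Rightarrow>\<^sub>0 int)" where
  "unshuffle A = frag_extend (\<lambda>g. frag_cmul ((-1) ^ crossings A g) (frag_of (elems_in A g, elems_out A g)))"

text \<open>The product on the tensor square of the free algebra on odd letters; the sign comes from
  moving c past b.\<close>

definition koszul_mult ::
    "('a list \<times> 'a list \<Rightarrow>\<^sub>0 int) \<Rightarrow> ('a list \<times> 'a list \<Rightarrow>\<^sub>0 int) \<Rightarrow> ('a list \<times> 'a list \<Rightarrow>\<^sub>0 int)" where
  "koszul_mult x y = frag_extend (\<lambda>(a, b). frag_extend (\<lambda>(c, d).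
     frag_cmul ((-1) ^ (length b * length c)) (frag_of (a @ c, b @ d))) y) x"

lemma koszul_mult_diff:
  "koszul_mult (x - x') y = koszul_mult x y - koszul_mult x' y"
  "koszul_mult x (y - y') = koszul_mult x y - koszul_mult x y'"
  by (simp_all add: koszul_mult_def frag_extend_diff frag_extend_diff_fun case_prod_beta')

lemma koszul_mult_cmul:
  "koszul_mult (frag_cmul k x) y = frag_cmul k (koszul_mult x y)"
  "koszul_mult x (frag_cmul k y) = frag_cmul k (koszul_mult x y)"
  by (simp_all add: koszul_mult_def frag_extend_cmul frag_extend_cmul_fun case_prod_beta')

lemma koszul_mult_zero [simp]: "koszul_mult 0 y = 0" "koszul_mult x 0 = 0"
  by (simp_all add: koszul_mult_def frag_extend_eq_0 case_prod_beta')

lemma unshuffle_zero [simp]: "unshuffle A 0 = 0"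
  by (simp add: unshuffle_def)

lemma unshuffle_diff: "unshuffle A (x - y) = unshuffle A x - unshuffle A y"
  by (simp add: unshuffle_def frag_extend_diff)

lemma unshuffle_add: "unshuffle A (x + y) = unshuffle A x + unshuffle A y"
  by (simp add: unshuffle_def frag_extend_add)

lemma unshuffle_cmul: "unshuffle A (frag_cmul k x) = frag_cmul k (unshuffle A x)"
  by (simp add: unshuffle_def frag_extend_cmul)

lemma unshuffle_of:
  "unshuffle A (frag_of g) = frag_cmul ((-1) ^ crossings A g) (frag_of (elems_in A g, elems_out A g))"
  by (simp add: unshuffle_def)

text \<open>Crossings of a concatenation are those within the two lists plus those between them, and
  the latter are exactly the Koszul sign. Hence vanishing on one factor gives vanishing on a
  product.\<close>

lemma unshuffle_append: "unshuffle A (x \<odot> y) = koszul_mult (unshuffle A x) (unshuffle A y)"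
proof (rule frag_induction[where S = UNIV and c = x
      and P = "\<lambda>x. unshuffle A (x \<odot> y) = koszul_mult (unshuffle A x) (unshuffle A y)"])
  fix g
  show "unshuffle A (frag_of g \<odot> y) = koszul_mult (unshuffle A (frag_of g)) (unshuffle A y)"
  proof (rule frag_induction[where S = UNIV and c = y
        and P = "\<lambda>y. unshuffle A (frag_of g \<odot> y) = koszul_mult (unshuffle A (frag_of g)) (unshuffle A y)"])
    fix h
    have "koszul_mult (frag_of (elems_in A g, elems_out A g)) (frag_of (elems_in A h, elems_out A h)) =
       frag_cmul ((-1) ^ (length (elems_out A g) * length (elems_in A h)))
         (frag_of (elems_in A (g @ h), elems_out A (g @ h)))"
      by (simp add: koszul_mult_def)
    then show "unshuffle A (frag_of g \<odot> frag_of h) =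
        koszul_mult (unshuffle A (frag_of g)) (unshuffle A (frag_of h))"
      by (simp add: unshuffle_of koszul_mult_cmul crossings_append power_add mult_ac)
  qed (simp_all add: frag_append_diff unshuffle_diff koszul_mult_diff)
qed (simp_all add: frag_append_diff unshuffle_diff koszul_mult_diff)

lemma keys_unshuffleE:
  assumes "p \<in> Poly_Mapping.keys (unshuffle A x)"
  obtains g where "g \<in> Poly_Mapping.keys x" "p = (elems_in A g, elems_out A g)"
  using assms unfolding unshuffle_def
  by (elim keys_frag_extendE) (auto simp: keys_frag_of)

lemma keys_wheel_rev: "g \<in> Poly_Mapping.keys (wheel_rev as) \<Longrightarrow> mset g = mset as"
proof (induction as arbitrary: g rule: wheel_rev.induct)
  case (3 a b bs)
  have "g \<in> Poly_Mapping.keys (wheel_rev (b # bs) \<odot> frag_of [a] +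
      frag_cmul ((-1) ^ length (a # b # bs)) (frag_of [a] \<odot> wheel_rev (b # bs)))"
    using "3.prems" by (simp only: wheel_rev.simps juxt_eq)
  then show ?case
  proof (rule keys_addE)
    assume "g \<in> Poly_Mapping.keys (wheel_rev (b # bs) \<odot> frag_of [a])"
    then show ?thesis
      by (rule keys_frag_appendE) (use "3.IH" in \<open>simp add: keys_frag_of\<close>)
  next
    assume "g \<in> Poly_Mapping.keys
      (frag_cmul ((-1) ^ length (a # b # bs)) (frag_of [a] \<odot> wheel_rev (b # bs)))"
    then have "g \<in> Poly_Mapping.keys (frag_of [a] \<odot> wheel_rev (b # bs))"
      by blast
    then show ?thesis
      by (rule keys_frag_appendE) (use "3.IH" in \<open>simp add: keys_frag_of\<close>)
  qed
qed (simp_all add: keys_frag_of)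

lemma keys_wheel: "g \<in> Poly_Mapping.keys (wheel as) \<Longrightarrow> mset g = mset as"
  unfolding wheel_def by (drule keys_wheel_rev) simp

text \<open>If A already separates the earlier labels, the induction hypothesis kills both terms of
  the recursion. Otherwise A only separates the newly added label from all earlier ones; both terms
  then give the same pair of lists, and the sign in the recursion makes them cancel.\<close>

lemma unshuffle_wheel_rev:
  assumes "distinct as" "\<not> set as \<subseteq> A" "set as \<inter> A \<noteq> {}"
  shows "unshuffle A (wheel_rev as) = 0"
  using assms
proof (induction as rule: wheel_rev.induct)
  case (3 a b bs)
  let ?cs = "b # bs" and ?x = "wheel_rev (b # bs)"
  show ?case
  proof (cases "set ?cs \<subseteq> A \<or> set ?cs \<inter> A = {}")
    case False
    then have "unshuffle A ?x = 0" using 3 by simp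
    then show ?thesis
      by (simp add: juxt_eq unshuffle_add unshuffle_cmul unshuffle_append)
  next
    case True
    have "unshuffle A (wheel_rev (a # ?cs)) =
      frag_extend (\<lambda>g. unshuffle A (frag_of (g @ [a])) +
        frag_cmul ((-1) ^ length (a # ?cs)) (unshuffle A (frag_of (a # g)))) ?x"
      (is "_ = frag_extend ?f ?x")
    proof -
      have "unshuffle A (y \<odot> frag_of [a]) = frag_extend (\<lambda>g. unshuffle A (frag_of (g @ [a]))) y"
        "unshuffle A (frag_of [a] \<odot> y) = frag_extend (\<lambda>g. unshuffle A (frag_of (a # g))) y" for y
        by (rule frag_induction[where S = UNIV and c = y];
            simp add: frag_append_diff unshuffle_diff frag_extend_diff)+
      then show ?thesis
        by (simp add: juxt_eq unshuffle_add unshuffle_cmul frag_extend_add_fun frag_extend_cmul_fun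
            del: power_Suc)
    qed
    also have "\<dots> = 0"
    proof (rule frag_extend_eq_0)
      fix g assume "g \<in> Poly_Mapping.keys ?x"
      then have "mset g = mset ?cs" by (rule keys_wheel_rev)
      then have g: "set g = set ?cs" "length g = length ?cs"
        by (metis mset_eq_setD, metis size_mset)
      consider "set g \<subseteq> A" "a \<notin> A" | "set g \<inter> A = {}" "a \<in> A"
        using True "3.prems" g(1) by auto
      then show "?f g = 0"
      proof cases
        case 1
        then have "elems_in A g = g" "elems_out A g = []" "crossings A g = 0"
          by (auto simp: filter_empty_conv filter_id_conv crossings_subset)
        with 1 show ?thesis
          by (simp add: unshuffle_of crossings_append g(2) flip: frag_cmul_distrib)
      next
        case 2
        then have "elems_in A g = []" "elems_out A g = g" "crossings A g = 0"
          by (auto simp: filter_empty_conv filter_id_conv crossings_disjoint)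
        with 2 show ?thesis
          by (simp add: unshuffle_of crossings_append g(2) flip: frag_cmul_distrib)
      qed
    qed
    finally show ?thesis .
  qed
qed auto

lemma unshuffle_wheel:
  assumes "distinct as" "\<not> set as \<subseteq> A" "set as \<inter> A \<noteq> {}"
  shows "unshuffle A (wheel as) = 0"
  unfolding wheel_def using assms by (intro unshuffle_wheel_rev) auto

lemma lookup_append_of: "Poly_Mapping.lookup (x \<odot> frag_of t) (s @ t) = Poly_Mapping.lookup x s"
  by (rule frag_induction[where S = UNIV and c = x])
    (auto simp: frag_append_diff lookup_minus)

text \<open>Of the two terms of the recursion only the one that appends the last label can produce
  the list itself; the other begins with that label.\<close>

lemma lookup_wheel:
  assumes "as \<noteq> []" "distinct as"
  shows "Poly_Mapping.lookup (wheel as) as = 1"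
proof -
  have "Poly_Mapping.lookup (wheel_rev as) (rev as) = 1" if "as \<noteq> []" "distinct as" for as
    using that
  proof (induction as rule: wheel_rev.induct)
    case (3 a b bs)
    have "rev (a # b # bs) \<notin> Poly_Mapping.keys (frag_of [a] \<odot> wheel_rev (b # bs))"
    proof
      assume "rev (a # b # bs) \<in> Poly_Mapping.keys (frag_of [a] \<odot> wheel_rev (b # bs))"
      then have "hd (rev (b # bs) @ [a]) = a"
        by (elim keys_frag_appendE) (auto simp: keys_frag_of)
      then have "hd (rev (b # bs)) = a" by (subst (asm) hd_append2) simp_all
      then have "a \<in> set (rev (b # bs))" by (metis hd_in_set rev_is_Nil_conv list.distinct(1))
      with "3.prems" show False by simp
    qed
    then have "Poly_Mapping.lookup (frag_of [a] \<odot> wheel_rev (b # bs)) (rev (a # b # bs)) = 0"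
      by (simp add: in_keys_iff)
    moreover have "Poly_Mapping.lookup (wheel_rev (b # bs) \<odot> frag_of [a]) (rev (a # b # bs)) = 1"
      using lookup_append_of[of "wheel_rev (b # bs)" "[a]" "rev (b # bs)"] 3 by simp
    ultimately show ?case
      unfolding wheel_rev.simps juxt_eq lookup_add lookup_frag_cmul by simp
  qed simp_all
  from this[of "rev as"] assms show ?thesis by (simp add: wheel_def)
qed

section \<open>The cellular boundary\<close>

definition symbol_dim :: "'a list list \<Rightarrow> nat"
  where "symbol_dim s = (\<Sum>b\<leftarrow>s. length b - 1)"

lemma symbol_dim_simps [simp]:
  "symbol_dim [] = 0" "symbol_dim (b # s) = (length b - 1) + symbol_dim s"
  "symbol_dim (s @ t) = symbol_dim s + symbol_dim t"
  by (simp_all add: symbol_dim_def)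

lemma symbol_dim_length: "[] \<notin> set s \<Longrightarrow> length s + symbol_dim s = length (concat s)"
proof (induction s)
  case (Cons b s)
  then have "b \<noteq> []" "length s + symbol_dim s = length (concat s)" by auto
  then show ?case by (cases b) auto
qed simp

lemma symbol_boundary_block [simp]: "symbol_boundary [g] = block_boundary g"
  by (simp add: bar_eq)

text \<open>The recursion defining the boundary splits off one block; this is the Leibniz rule for
  an arbitrary split.\<close>

lemma symbol_boundary_append:
  "symbol_boundary (s @ t) = symbol_boundary s \<odot> frag_of t
     + frag_cmul ((-1) ^ symbol_dim s) (frag_of s \<odot> symbol_boundary t)"
proof (induction s)
  case (Cons g s)
  have "frag_of [g] \<odot> frag_of s \<odot> x = frag_of (g # s) \<odot> x" for x
    using frag_append_assoc[of "frag_of [g]" "frag_of s" x] by simp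
  then show ?case
    using Cons
    by (simp add: bar_eq frag_append_add frag_append_assoc frag_cmul_distrib2 power_add add.assoc)
qed simp

lemma cel_boundary_simps [simp]:
  "cel_boundary 0 = 0" "cel_boundary (frag_of s) = symbol_boundary s"
  by (simp_all add: cel_boundary_def)

lemma cel_boundary_diff: "cel_boundary (x - y) = cel_boundary x - cel_boundary y"
  by (simp add: cel_boundary_def frag_extend_diff)

lemma cel_boundary_add: "cel_boundary (x + y) = cel_boundary x + cel_boundary y"
  by (simp add: cel_boundary_def frag_extend_add)

lemma cel_boundary_cmul: "cel_boundary (frag_cmul k x) = frag_cmul k (cel_boundary x)"
  by (simp add: cel_boundary_def frag_extend_cmul)

text \<open>Homogeneity of the left factor is what allows a single sign for the whole chain.\<close>

lemma cel_boundary_append: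
  assumes "\<And>s. s \<in> Poly_Mapping.keys x \<Longrightarrow> symbol_dim s = d"
  shows "cel_boundary (x \<odot> y) = cel_boundary x \<odot> y + frag_cmul ((-1) ^ d) (x \<odot> cel_boundary y)"
proof (rule frag_induction[where S = "{s. symbol_dim s = d}" and c = x
      and P = "\<lambda>x. cel_boundary (x \<odot> y) = cel_boundary x \<odot> y + frag_cmul ((-1) ^ d) (x \<odot> cel_boundary y)"])
  show "Poly_Mapping.keys x \<subseteq> {s. symbol_dim s = d}" using assms by auto
next
  fix s :: symbol assume "s \<in> {s. symbol_dim s = d}"
  then have d: "symbol_dim s = d" by simp
  show "cel_boundary (frag_of s \<odot> y) =
      cel_boundary (frag_of s) \<odot> y + frag_cmul ((-1) ^ d) (frag_of s \<odot> cel_boundary y)"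
    by (rule frag_induction[where S = UNIV and c = y])
      (simp_all add: frag_append_diff cel_boundary_diff frag_cmul_diff symbol_boundary_append d)
qed (simp_all add: frag_append_diff cel_boundary_diff frag_cmul_diff)

lemma as_block_of [simp]: "as_block (frag_of g) = frag_of [g]"
  by (simp add: as_block_def)

lemma cel_boundary_as_block: "cel_boundary (as_block x) = frag_extend block_boundary x"
  by (rule frag_induction[where S = UNIV and c = x])
    (simp_all add: as_block_def cel_boundary_diff frag_extend_diff del: symbol_boundary.simps)

text \<open>Since all lists carry the same label set, the sum over A can be taken outside. A block
  chain on which all proper unshuffles vanish is therefore a cycle.\<close>

lemma cel_boundary_block_chain:
  assumes "\<And>g. g \<in> Poly_Mapping.keys x \<Longrightarrow> distinct g \<and> set g = L"
  shows "cel_boundary (as_block x) = (\<Sum>A\<in>proper_subsets L.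
    frag_cmul ((-1) ^ card A) (frag_extend (\<lambda>(a, b). frag_of [a, b]) (unshuffle A x)))"
proof -
  have "frag_extend block_boundary x = frag_extend (\<lambda>g. \<Sum>A\<in>proper_subsets L.
      frag_cmul ((-1) ^ card A) (frag_extend (\<lambda>(a, b). frag_of [a, b]) (unshuffle A (frag_of g)))) x"
    using assms
    by (intro frag_extend_eq) (auto simp: block_boundary_unshuffle unshuffle_of frag_extend_cmul power_add
        intro!: sum.cong)
  moreover have "frag_extend (\<lambda>g. frag_extend (\<lambda>(a, b). frag_of [a, b]) (unshuffle A (frag_of g))) x =
      frag_extend (\<lambda>(a, b). frag_of [a, b]) (unshuffle A x)" for A
    by (rule frag_induction[where S = UNIV and c = x])
      (simp_all add: unshuffle_diff frag_extend_diff)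
  ultimately show ?thesis
    by (simp add: cel_boundary_as_block frag_extend_sum_fun frag_extend_cmul_fun)
qed

lemma cel_boundary_sum: "finite I \<Longrightarrow> cel_boundary (\<Sum>i\<in>I. f i) = (\<Sum>i\<in>I. cel_boundary (f i))"
  by (simp add: cel_boundary_def frag_extend_sum)

lemma frag_append_sum_right: "finite I \<Longrightarrow> x \<odot> (\<Sum>i\<in>I. f i) = (\<Sum>i\<in>I. x \<odot> f i)"
  by (simp add: frag_append_def frag_extend_sum frag_extend_sum_fun)

lemma keys_block_boundaryE:
  assumes "s \<in> Poly_Mapping.keys (block_boundary g)"
  obtains a b where "s = [a, b]" "a \<noteq> []" "b \<noteq> []" "mset g = mset a + mset b"
proof -
  from assms obtain p where p: "p \<in> {(a, b). a \<noteq> [] \<and> b \<noteq> [] \<and> g \<in> shuffles a b}"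
    "s \<in> Poly_Mapping.keys (case p of (a, b) \<Rightarrow>
      frag_cmul ((-1) ^ length a * rearrangement_sign g (a @ b)) (frag_of [a, b]))"
    unfolding block_boundary_def by (rule keys_sumE)
  obtain a b where ab: "p = (a, b)" by (cases p)
  have "s = [a, b]" using p(2) by (simp add: ab keys_frag_of)
  moreover have "a \<noteq> []" "b \<noteq> []" "g \<in> shuffles a b" using p(1) by (simp_all add: ab)
  ultimately show thesis using that mset_shuffles by metis
qed

text \<open>Each symbol with three blocks B, C and the rest arises twice: by splitting B together
  with C off first, or by splitting B off first. The two signs are opposite.\<close>

lemma cel_boundary_block_boundary:
  assumes g: "distinct g"
  shows "cel_boundary (block_boundary g) = 0"
proof -
  let ?L = "set g"
  \<comment> \<open>The signed symbol with first two blocks on B and C, normalised so that it occurs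
    with a plus sign when B and C are split off together and with a minus sign when B is split off
    alone.\<close>
  define T where "T = (\<lambda>B C. frag_cmul ((-1) ^ (card C + crossings B g + crossings C (elems_out B g)))
    (frag_of [elems_in B g, elems_in C g, elems_out (B \<union> C) g]))"
  have split: "cel_boundary (frag_cmul ((-1) ^ (card A + crossings A g)) (frag_of [elems_in A g, elems_out A g]))
      = (\<Sum>B\<in>proper_subsets A. T B (A - B)) - (\<Sum>C\<in>proper_subsets (?L - A). T A C)"
    if A: "A \<in> proper_subsets ?L" for A
  proof -
    let ?k = "(-1) ^ (card A + crossings A g) :: int"
    from A have sub: "A \<subseteq> ?L" "A \<noteq> {}" by (auto simp: proper_subsets_def)
    then have fin: "finite A" by (meson List.finite_set finite_subset)
    have sets: "set (elems_in A g) = A" "set (elems_out A g) = ?L - A" using sub by auto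
    have "length (elems_in A g) = card A" using g sets(1) by (metis distinct_card distinct_filter)
    moreover have "card A > 0" using fin sub(2) by (simp add: card_gt_0_iff)
    ultimately obtain m where m: "length (elems_in A g) = Suc m" "card A = Suc m"
      by (metis gr0_implies_Suc)
    have 1: "frag_cmul ?k (block_boundary (elems_in A g) \<odot> frag_of [elems_out A g])
        = (\<Sum>B\<in>proper_subsets A. T B (A - B))"
    proof -
      have "frag_cmul ?k (frag_cmul ((-1) ^ (card B + crossings B (elems_in A g)))
          (frag_of [elems_in B (elems_in A g), elems_out B (elems_in A g)]) \<odot> frag_of [elems_out A g]) = T B (A - B)"
        if B: "B \<in> proper_subsets A" for B
      proof -
        have BA: "B \<subseteq> A" "B \<union> (A - B) = A" using B by (auto simp: proper_subsets_def)
        have lists: "elems_in B (elems_in A g) = elems_in B g" "elems_out B (elems_in A g) = elems_in (A - B) g"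
          using BA(1) by (auto intro!: filter_cong)
        have "crossings A g + crossings B (elems_in A g) = crossings B g + crossings (A - B) (elems_out B g)"
          using crossings_coassoc[OF Diff_disjoint[of B A], of g] unfolding BA(2) .
        moreover have "card A = card (A - B) + card B"
          using BA(1) fin by (simp add: card_Diff_subset finite_subset card_mono)
        ultimately have "(card A + crossings A g) + (card B + crossings B (elems_in A g))
            = (card (A - B) + crossings B g + crossings (A - B) (elems_out B g)) + 2 * card B"
          by simp
        then have "?k * (-1) ^ (card B + crossings B (elems_in A g))
            = (-1) ^ (card (A - B) + crossings B g + crossings (A - B) (elems_out B g))"
          by (metis (no_types, lifting) power_add power_mult power2_minus one_power2 power_one mult.right_neutral)
        then show ?thesis
          by (simp only: frag_append_cmul frag_append_of frag_cmul_cmul T_def lists BA(2) append.simps)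
      qed
      then show ?thesis
        using g by (simp only: block_boundary_unshuffle distinct_filter sets frag_append_sum_left
            finite_proper_subsets fin frag_cmul_sum cong: sum.cong)
    qed
    have 2: "frag_cmul ?k (frag_cmul ((-1) ^ m) (frag_of [elems_in A g] \<odot> block_boundary (elems_out A g)))
        = - (\<Sum>C\<in>proper_subsets (?L - A). T A C)"
    proof -
      have "frag_cmul ?k (frag_cmul ((-1) ^ m) (frag_of [elems_in A g] \<odot>
          frag_cmul ((-1) ^ (card C + crossings C (elems_out A g)))
            (frag_of [elems_in C (elems_out A g), elems_out C (elems_out A g)]))) = - T A C"
        if C: "C \<in> proper_subsets (?L - A)" for C
      proof -
        have lists: "elems_in C (elems_out A g) = elems_in C g" "elems_out C (elems_out A g) = elems_out (A \<union> C) g"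
          using C by (auto simp: proper_subsets_def intro!: filter_cong)
        \<comment> \<open>The dimension of the first block is \<open>m\<close>, one less than
          \<open>card A\<close>; this difference produces the minus sign.\<close>
        have "?k * ((-1) ^ m * (-1) ^ (card C + crossings C (elems_out A g)))
            = - ((-1) ^ (card C + crossings A g + crossings C (elems_out A g)) * ((-1) ^ m * (-1) ^ m))"
          by (simp add: m(2) power_add)
        also have "(-1) ^ m * (-1) ^ m = (1::int)" by (simp flip: power_mult_distrib)
        finally show ?thesis
          by (simp add: T_def lists mult.assoc del: filter_filter)
      qed
      then show ?thesis
        using g by (simp only: block_boundary_unshuffle distinct_filter sets frag_append_sum_right
            finite_proper_subsets finite_Diff List.finite_set frag_cmul_sum sum_negf cong: sum.cong)
    qed
    have "symbol_boundary [elems_in A g, elems_out A g] = block_boundary (elems_in A g) \<odot> frag_of [elems_out A g]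
        + frag_cmul ((-1) ^ m) (frag_of [elems_in A g] \<odot> block_boundary (elems_out A g))"
      using symbol_boundary_append[of "[elems_in A g]" "[elems_out A g]"] by (simp add: m(1) del: symbol_boundary.simps)
    then show ?thesis
      by (simp only: cel_boundary_cmul cel_boundary_simps frag_cmul_distrib2 1 2) simp
  qed
  have "(\<Sum>A\<in>proper_subsets ?L. \<Sum>B\<in>proper_subsets A. T B (A - B))
      = (\<Sum>(A, B)\<in>Sigma (proper_subsets ?L) proper_subsets. T B (A - B))"
    by (rule sum.Sigma) (auto simp: proper_subsets_def intro: finite_subset)
  \<comment> \<open>A chain B inside A inside L is the same datum as an ordered pair of disjoint
    nonempty sets B and A - B that leave something over.\<close>
  also have "\<dots> = (\<Sum>(B, C)\<in>Sigma (proper_subsets ?L) (\<lambda>B. proper_subsets (?L - B)). T B C)"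
    by (rule sum.reindex_bij_witness[where i = "\<lambda>(B, C). (B \<union> C, B)" and j = "\<lambda>(A, B). (B, A - B)"])
      (auto simp: proper_subsets_def, blast+)
  also have "\<dots> = (\<Sum>B\<in>proper_subsets ?L. \<Sum>C\<in>proper_subsets (?L - B). T B C)"
    by (rule sum.Sigma[symmetric]) auto
  finally show ?thesis
    by (simp add: block_boundary_unshuffle[OF g] cel_boundary_sum split sum_subtractf)
qed

lemma cel_boundary_symbol_boundary:
  "distinct (concat s) \<Longrightarrow> cel_boundary (symbol_boundary s) = 0"
proof (induction s)
  case (Cons g s)
  let ?b = "block_boundary g"
  have dim: "symbol_dim t = length g - 2 \<and> length g \<ge> 2" if "t \<in> Poly_Mapping.keys ?b" for t
  proof -
    from that obtain a b where ab: "t = [a, b]" "a \<noteq> []" "b \<noteq> []" "mset g = mset a + mset b"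
      by (rule keys_block_boundaryE)
    have "length g = length a + length b" using ab(4) by (metis size_mset size_union)
    with ab(1-3) show ?thesis by (cases a; cases b) auto
  qed
  have 1: "cel_boundary (?b \<odot> frag_of s) = frag_cmul ((-1) ^ (length g - 2)) (?b \<odot> symbol_boundary s)"
    using Cons.prems dim by (subst cel_boundary_append[where d = "length g - 2"])
      (auto simp: cel_boundary_block_boundary)
  have 2: "cel_boundary (frag_of [g] \<odot> symbol_boundary s) = ?b \<odot> symbol_boundary s"
    using Cons by (subst cel_boundary_append[where d = "length g - 1"])
      (auto simp: keys_frag_of simp del: symbol_boundary.simps)
  have "cel_boundary (symbol_boundary (g # s)) =
      frag_cmul ((-1) ^ (length g - 2) + (-1) ^ (length g - 1)) (?b \<odot> symbol_boundary s)"
    by (simp add: bar_eq cel_boundary_add cel_boundary_cmul 1 2 frag_cmul_distrib)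
  also have "\<dots> = 0"
  \<comment> \<open>For length at most one, truncated subtraction makes the two signs agree, but
    then the block has no faces.\<close>
  proof (cases "length g \<ge> 2")
    case True
    then obtain m where "length g = Suc (Suc m)" by (metis add_2_eq_Suc le_Suc_ex)
    then show ?thesis by simp
  next
    case False
    then have "Poly_Mapping.keys ?b = {}" using dim by blast
    then show ?thesis by simp
  qed
  finally show ?case .
qed simp

text \<open>Cells over an arbitrary label set, graded by \<open>symbol_dim\<close> instead of by the
  number of bars relative to n, so that the pieces of a concatenation can be treated separately and
  their dimensions add.\<close>

definition cells_on :: "'a set \<Rightarrow> nat \<Rightarrow> nat \<Rightarrow> 'a list list set" where
  "cells_on L w d = {s. [] \<notin> set s \<and> distinct (concat s) \<and> set (concat s) = L \<and>
     (\<forall>b\<in>set s. length b \<le> w) \<and> symbol_dim s = d}"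

lemma cells_eq_cells_on: "cells n w d = cells_on {1..n} w d"
proof -
  have "length s + d = n \<longleftrightarrow> symbol_dim s = d"
    if "[] \<notin> set s" "distinct (concat s)" "set (concat s) = {1..n}" for s
  proof -
    have "length (concat s) = n" using that(2,3) by (metis distinct_card card_atLeastAtMost diff_Suc_1)
    then show ?thesis using symbol_dim_length[OF that(1)] by linarith
  qed
  then show ?thesis unfolding cells_def cells_on_def by blast
qed

lemma cells_on_mono: "w \<le> w' \<Longrightarrow> cells_on L w d \<subseteq> cells_on L w' d"
  by (auto simp: cells_on_def)

lemma keys_frag_append_cells_on:
  assumes "Poly_Mapping.keys x \<subseteq> cells_on K w d" "Poly_Mapping.keys y \<subseteq> cells_on L w e" "K \<inter> L = {}"
  shows "Poly_Mapping.keys (x \<odot> y) \<subseteq> cells_on (K \<union> L) w (d + e)"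
proof
  fix u assume "u \<in> Poly_Mapping.keys (x \<odot> y)"
  then obtain s t where "s \<in> cells_on K w d" "t \<in> cells_on L w e" "u = s @ t"
    using assms(1,2) by (elim keys_frag_appendE) blast
  then show "u \<in> cells_on (K \<union> L) w (d + e)"
    using assms(3) unfolding cells_on_def by auto
qed

lemma keys_symbol_boundary:
  assumes "t \<in> Poly_Mapping.keys (symbol_boundary s)" "[] \<notin> set s"
  shows "[] \<notin> set t \<and> mset (concat t) = mset (concat s) \<and> length t = Suc (length s) \<and>
    (\<forall>b\<in>set t. \<exists>c\<in>set s. length b \<le> length c)"
  using assms
proof (induction s arbitrary: t)
  case (Cons g s)
  have "t \<in> Poly_Mapping.keys (block_boundary g \<odot> frag_of s +
      frag_cmul ((-1) ^ (length g - 1)) (frag_of [g] \<odot> symbol_boundary s))"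
    using Cons.prems(1) by (simp only: symbol_boundary.simps bar_eq)
  then show ?case
  proof (rule keys_addE)
    assume "t \<in> Poly_Mapping.keys (block_boundary g \<odot> frag_of s)"
    then obtain u where u: "u \<in> Poly_Mapping.keys (block_boundary g)" "t = u @ s"
      by (rule keys_frag_appendE) (simp add: keys_frag_of)
    from u(1) obtain a b where ab: "u = [a, b]" "a \<noteq> []" "b \<noteq> []" "mset g = mset a + mset b"
      by (rule keys_block_boundaryE)
    have "length a \<le> length g" "length b \<le> length g"
      using ab(4) by (metis size_mset size_union le_add1 le_add2)+
    then show ?thesis
      using Cons.prems(2) u(2) ab by auto
  next
    assume "t \<in> Poly_Mapping.keys (frag_cmul ((-1) ^ (length g - 1)) (frag_of [g] \<odot> symbol_boundary s))"
    then have "t \<in> Poly_Mapping.keys (frag_of [g] \<odot> symbol_boundary s)" by blast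
    then obtain u where u: "u \<in> Poly_Mapping.keys (symbol_boundary s)" "t = g # u"
      by (rule keys_frag_appendE) (simp add: keys_frag_of)
    with Cons.IH[of u] Cons.prems(2) show ?thesis by auto
  qed
qed simp

lemma keys_cel_boundary:
  assumes "Poly_Mapping.keys x \<subseteq> cells_on L w (Suc d)"
  shows "Poly_Mapping.keys (cel_boundary x) \<subseteq> cells_on L w d"
proof
  fix t assume "t \<in> Poly_Mapping.keys (cel_boundary x)"
  then obtain s where s: "s \<in> cells_on L w (Suc d)" "t \<in> Poly_Mapping.keys (symbol_boundary s)"
    using assms unfolding cel_boundary_def by (elim keys_frag_extendE) blast
  from s(1) have s': "[] \<notin> set s" "distinct (concat s)" "set (concat s) = L"
    "\<forall>b\<in>set s. length b \<le> w" "symbol_dim s = Suc d"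
    by (simp_all add: cells_on_def)
  note t = keys_symbol_boundary[OF s(2) s'(1)]
  have m: "mset (concat t) = mset (concat s)" using t by blast
  have "distinct (concat t)" "set (concat t) = L" "length (concat t) = length (concat s)"
    using mset_eq_imp_distinct_iff[OF m] mset_eq_setD[OF m] mset_eq_length[OF m] s'(2,3) by simp_all
  moreover have "\<forall>b\<in>set t. length b \<le> w"
    using t s'(4) by (meson le_trans)
  moreover have "symbol_dim t = d"
    using symbol_dim_length[of t] symbol_dim_length[of s] t s'(1,5) calculation(3) by linarith
  ultimately show "t \<in> cells_on L w d"
    using t by (simp add: cells_on_def)
qed

lemma cel_boundary_cel_boundary:
  assumes "Poly_Mapping.keys x \<subseteq> cells_on L w d"
  shows "cel_boundary (cel_boundary x) = 0"
  using assms
  by (rule frag_induction) (simp_all add: cel_boundary_diff cel_boundary_symbol_boundary cells_on_def)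

section \<open>Wheels and filters are cycles\<close>

lemma keys_as_blockE:
  assumes "s \<in> Poly_Mapping.keys (as_block x)"
  obtains g where "g \<in> Poly_Mapping.keys x" "s = [g]"
  using assms unfolding as_block_def by (elim keys_frag_extendE) (simp add: keys_frag_of)

lemma keys_as_block_cells_on:
  assumes "\<And>g. g \<in> Poly_Mapping.keys x \<Longrightarrow> mset g = mset as" "distinct as" "as \<noteq> []" "length as \<le> w"
  shows "Poly_Mapping.keys (as_block x) \<subseteq> cells_on (set as) w (length as - 1)"
proof
  fix s assume "s \<in> Poly_Mapping.keys (as_block x)"
  then obtain g where g: "g \<in> Poly_Mapping.keys x" "s = [g]" by (rule keys_as_blockE)
  have m: "mset g = mset as" by (rule assms(1)[OF g(1)])
  have "distinct g" "set g = set as" "length g = length as"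
    using mset_eq_imp_distinct_iff[OF m] mset_eq_setD[OF m] mset_eq_length[OF m] assms(2) by simp_all
  then show "s \<in> cells_on (set as) w (length as - 1)"
    using assms(3,4) g(2) by (auto simp: cells_on_def)
qed

text \<open>Every proper subset of the labels separates the wheel, so each unshuffle in the boundary
  vanishes.\<close>

lemma cel_boundary_wheel:
  assumes "distinct as"
  shows "cel_boundary (as_block (wheel as)) = 0"
proof -
  have "distinct g \<and> set g = set as" if "g \<in> Poly_Mapping.keys (wheel as)" for g
    using keys_wheel[OF that] assms by (metis mset_eq_imp_distinct_iff mset_eq_setD)
  moreover have "unshuffle A (wheel as) = 0" if "A \<in> proper_subsets (set as)" for A
    using that assms by (intro unshuffle_wheel) (auto simp: proper_subsets_def)
  ultimately show ?thesis
    by (subst cel_boundary_block_chain) (auto intro: sum.neutral)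
qed

definition wheel_product :: "nat list list \<Rightarrow> (nat list \<Rightarrow>\<^sub>0 int)"
  where "wheel_product ws = foldr juxt (map wheel ws) (frag_of [])"

lemma wheel_product_simps [simp]:
  "wheel_product [] = frag_of []" "wheel_product (v # ws) = wheel v \<odot> wheel_product ws"
  by (simp_all add: wheel_product_def juxt_eq)

lemma keys_wheel_product: "g \<in> Poly_Mapping.keys (wheel_product ws) \<Longrightarrow> mset g = mset (concat ws)"
proof (induction ws arbitrary: g)
  case (Cons v ws)
  then obtain a b where "a \<in> Poly_Mapping.keys (wheel v)" "b \<in> Poly_Mapping.keys (wheel_product ws)" "g = a @ b"
    unfolding wheel_product_simps by (elim keys_frag_appendE) blast
  then show ?case using Cons.IH keys_wheel by simp
qed (simp add: keys_frag_of)

lemma unshuffle_wheel_product: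
  assumes "v \<in> set ws" "unshuffle A (wheel v) = 0"
  shows "unshuffle A (wheel_product ws) = 0"
  using assms by (induction ws) (auto simp: unshuffle_append)

text \<open>Each part of a splitting between whole wheels misses a wheel, which bounds its width.\<close>

lemma keys_filter_width:
  assumes ws: "distinct (concat ws)" "\<And>v. v \<in> set ws \<Longrightarrow> length (concat ws) \<le> length v + w"
    and t: "t \<in> Poly_Mapping.keys (cel_boundary (as_block (wheel_product ws)))" and b: "b \<in> set t"
  shows "length b \<le> w"
proof -
  let ?L = "set (concat ws)"
  have key: "distinct g \<and> set g = ?L \<and> length g = length (concat ws)"
    if "g \<in> Poly_Mapping.keys (wheel_product ws)" for g
    using keys_wheel_product[OF that] ws(1) by (metis mset_eq_imp_distinct_iff mset_eq_setD mset_eq_length)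
  have "t \<in> Poly_Mapping.keys (\<Sum>A\<in>proper_subsets ?L. frag_cmul ((-1) ^ card A)
      (frag_extend (\<lambda>(a, b). frag_of [a, b]) (unshuffle A (wheel_product ws))))"
    using t key by (subst (asm) cel_boundary_block_chain[where L = ?L]) blast+
  then obtain A where A: "A \<in> proper_subsets ?L"
    "t \<in> Poly_Mapping.keys (frag_extend (\<lambda>(a, b). frag_of [a, b]) (unshuffle A (wheel_product ws)))"
    by (elim keys_sumE) blast
  from A(2) obtain p where p: "p \<in> Poly_Mapping.keys (unshuffle A (wheel_product ws))"
    "t \<in> Poly_Mapping.keys (case p of (a, b) \<Rightarrow> frag_of [a, b])"
    by (rule keys_frag_extendE)
  from p(1) obtain g where g: "g \<in> Poly_Mapping.keys (wheel_product ws)" "p = (elems_in A g, elems_out A g)"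
    by (rule keys_unshuffleE)
  have tg: "t = [elems_in A g, elems_out A g]" using p(2) g(2) by (simp add: keys_frag_of)
  have sum: "length (elems_in A g) + length (elems_out A g) = length (concat ws)"
    using key[OF g(1)] by (metis sum_length_filter_compl)
  \<comment> \<open>A set that separates one wheel kills the whole product, but A contributes a term
    here.\<close>
  have mixed: "set v \<subseteq> A \<or> set v \<inter> A = {}" if "v \<in> set ws" for v
  proof (rule ccontr)
    assume "\<not> ?thesis"
    moreover have "distinct v" using ws(1) that by (simp add: distinct_concat_iff)
    ultimately have "unshuffle A (wheel_product ws) = 0"
      using that by (intro unshuffle_wheel_product unshuffle_wheel) auto
    with p(1) show False by simp
  qed
  have long: "length v \<le> length h" if "v \<in> set ws" "set v \<subseteq> set h" for v and h :: "nat list"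
    using that ws(1) by (metis List.finite_set card_length card_mono distinct_card distinct_concat_iff le_trans)
  have in_g: "set (concat ws) = set g" using key[OF g(1)] by simp
  have "A \<noteq> {}" "A \<subset> ?L"
    using A(1) by (auto simp: proper_subsets_def)
  then obtain x y where x: "x \<in> ?L" "x \<in> A" and y: "y \<in> ?L" "y \<notin> A"
    by blast
  obtain v where v: "v \<in> set ws" "x \<in> set v" using x by auto
  obtain u where u: "u \<in> set ws" "y \<in> set u" using y by auto
  have "set v \<subseteq> set (elems_in A g)" using mixed[OF v(1)] v x(2) in_g by auto
  moreover have "set u \<subseteq> set (elems_out A g)" using mixed[OF u(1)] u y(2) in_g by auto
  ultimately have "length v \<le> length (elems_in A g)" "length u \<le> length (elems_out A g)"
    \<comment> \<open>The part inside A contains the wheel \<open>v\<close>, the part outside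
      contains \<open>u\<close>. Each part has the remaining disks at most, hence at most
      \<open>w\<close>.\<close>
    using long u(1) v(1) by blast+
  then have "length (elems_out A g) \<le> w" "length (elems_in A g) \<le> w"
    using sum ws(2)[OF u(1)] ws(2)[OF v(1)] by linarith+
  then show ?thesis using b tg by auto
qed

section \<open>Labels, chains and dimensions of concatenations\<close>

definition comp_labels :: "component \<Rightarrow> nat list"
  where "comp_labels x = concat (comp_wheels x)"

definition cycle_labels :: "component list \<Rightarrow> nat list"
  where "cycle_labels c = concat (map comp_labels c)"

lemma comp_labels_simps [simp]:
  "comp_labels (Wheel as) = as" "comp_labels (Filter ws) = concat ws"
  by (simp_all add: comp_labels_def)

lemma cycle_labels_simps [simp]:
  "cycle_labels [] = []" "cycle_labels (x # c) = comp_labels x @ cycle_labels c"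
  "cycle_labels (c @ c') = cycle_labels c @ cycle_labels c'"
  by (simp_all add: cycle_labels_def)

lemma concat_comp_wheels: "concat (concat (map comp_wheels c)) = cycle_labels c"
  by (induction c) (simp_all add: comp_labels_def)

lemma keys_filter_product:
  assumes "comp_allowed w (Filter ws)" "distinct (concat ws)" "length (concat ws) \<le> w'"
  shows "Poly_Mapping.keys (as_block (wheel_product ws)) \<subseteq>
    cells_on (set (concat ws)) w' (Suc (comp_dim (Filter ws)))"
proof -
  have "\<exists>u v ws'. ws = u # v # ws'" using assms(1) by (cases ws; cases "tl ws") auto
  then obtain u v ws' where ws: "ws = u # v # ws'" by blast
  have "u \<noteq> []" "v \<noteq> []" using assms(1) ws by auto
  \<comment> \<open>Two nonempty wheels give at least two disks, so the truncated subtraction in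
    \<open>comp_dim\<close> is exact.\<close>
  then have k: "Suc (length (concat ws) - 2) = length (concat ws) - 1" "concat ws \<noteq> []"
    using ws by (cases u; cases v; simp)+
  show ?thesis
    using keys_as_block_cells_on[of "wheel_product ws" "concat ws" w'] keys_wheel_product assms(2,3) k by simp
qed

lemma comp_chain_cycle:
  assumes "comp_allowed w x" "distinct (comp_labels x)"
  shows "Poly_Mapping.keys (comp_chain x) \<subseteq> cells_on (set (comp_labels x)) w (comp_dim x)"
    and "cel_boundary (comp_chain x) = 0"
proof (atomize (full), cases x)
  case (Wheel as)
  then show "Poly_Mapping.keys (comp_chain x) \<subseteq> cells_on (set (comp_labels x)) w (comp_dim x) \<and>
      cel_boundary (comp_chain x) = 0"
    using assms keys_as_block_cells_on[of "wheel as" as w] keys_wheel cel_boundary_wheel by simp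
next
  case (Filter ws)
  let ?P = "as_block (wheel_product ws)"
  have d: "distinct (concat ws)" using assms(2) Filter by simp
  have ch: "comp_chain x = cel_boundary ?P" by (simp add: Filter wheel_product_def)
  \<comment> \<open>The product block does not fit into width \<open>w\<close>; its boundary is
    first placed in width k and then seen to have only narrow blocks.\<close>
  have k: "Poly_Mapping.keys ?P \<subseteq> cells_on (set (concat ws)) (length (concat ws)) (Suc (comp_dim x))"
    using keys_filter_product[of w ws] assms(1) Filter d by simp
  have "Poly_Mapping.keys (cel_boundary ?P) \<subseteq> cells_on (set (concat ws)) (length (concat ws)) (comp_dim x)"
    by (rule keys_cel_boundary[OF k])
  moreover have "length b \<le> w" if "t \<in> Poly_Mapping.keys (cel_boundary ?P)" "b \<in> set t" for t b
  proof (rule keys_filter_width[OF d _ that])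
    fix v assume "v \<in> set ws"
    then show "length (concat ws) \<le> length v + w" using assms(1) Filter by fastforce
  qed
  ultimately have "Poly_Mapping.keys (cel_boundary ?P) \<subseteq> cells_on (set (concat ws)) w (comp_dim x)"
    unfolding cells_on_def by blast
  then show "Poly_Mapping.keys (comp_chain x) \<subseteq> cells_on (set (comp_labels x)) w (comp_dim x) \<and>
      cel_boundary (comp_chain x) = 0"
    using cel_boundary_cel_boundary[OF k] ch Filter by simp
qed

lemma cycle_chain_simps [simp]:
  "cycle_chain [] = frag_of []" "cycle_chain (x # c) = comp_chain x \<odot> cycle_chain c"
  by (simp_all add: cycle_chain_def bar_eq)

lemma cycle_chain_append: "cycle_chain (c @ c') = cycle_chain c \<odot> cycle_chain c'"
  by (induction c) (simp_all add: frag_append_assoc)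

lemma cycle_dim_simps [simp]:
  "cycle_dim [] = 0" "cycle_dim (x # c) = comp_dim x + cycle_dim c"
  "cycle_dim (c @ c') = cycle_dim c + cycle_dim c'"
  by (simp_all add: cycle_dim_def)

lemma symbol_dim_cells_on: "Poly_Mapping.keys x \<subseteq> cells_on L w d \<Longrightarrow> s \<in> Poly_Mapping.keys x \<Longrightarrow> symbol_dim s = d"
  by (auto simp: cells_on_def)

lemma cycle_chain_cycle:
  assumes "\<forall>x\<in>set c. comp_allowed w x" "distinct (cycle_labels c)"
  shows "Poly_Mapping.keys (cycle_chain c) \<subseteq> cells_on (set (cycle_labels c)) w (cycle_dim c) \<and>
    cel_boundary (cycle_chain c) = 0"
  using assms
proof (induction c)
  case Nil
  show ?case by (simp add: keys_frag_of cells_on_def)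
next
  case (Cons x c)
  have x: "Poly_Mapping.keys (comp_chain x) \<subseteq> cells_on (set (comp_labels x)) w (comp_dim x)"
    "cel_boundary (comp_chain x) = 0"
    using comp_chain_cycle[of w x] Cons.prems by simp_all
  have c: "Poly_Mapping.keys (cycle_chain c) \<subseteq> cells_on (set (cycle_labels c)) w (cycle_dim c)"
    "cel_boundary (cycle_chain c) = 0"
    using Cons by auto
  have "cel_boundary (comp_chain x \<odot> cycle_chain c) = 0"
    using cel_boundary_append[OF symbol_dim_cells_on[OF x(1)]] x(2) c(2) by simp
  moreover have "set (comp_labels x) \<inter> set (cycle_labels c) = {}"
    using Cons.prems(2) by simp
  ultimately show ?case
    using keys_frag_append_cells_on[OF x(1) c(1)] by simp
qed

text \<open>Once the width admits the one-block product whose boundary is the filter, putting that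
  product in place of the filter gives a bounding chain, because all other components are
  cycles.\<close>

lemma filter_cycle_bounds:
  assumes c: "\<forall>x\<in>set c. comp_allowed w x" "distinct (cycle_labels c)"
    and ws: "Filter ws \<in> set c" "length (concat ws) \<le> w'"
  obtains y where "Poly_Mapping.keys y \<subseteq> cells_on (set (cycle_labels c)) w' (Suc (cycle_dim c))"
    "cel_boundary y = cycle_chain c"
proof -
  from ws(1) obtain p q where pq: "c = p @ Filter ws # q" by (meson split_list)
  let ?P = "as_block (wheel_product ws)"
  have cF: "comp_allowed w (Filter ws)" using c(1) ws(1) by blast
  then have "w \<le> w'" using ws(2) by simp
  have pc: "\<forall>x\<in>set p. comp_allowed w x" "distinct (cycle_labels p)"
    and qc: "\<forall>x\<in>set q. comp_allowed w x" "distinct (cycle_labels q)"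
    using c by (simp_all add: pq)
  have p: "Poly_Mapping.keys (cycle_chain p) \<subseteq> cells_on (set (cycle_labels p)) w' (cycle_dim p)"
    "cel_boundary (cycle_chain p) = 0"
    using cycle_chain_cycle[OF pc] cells_on_mono[OF \<open>w \<le> w'\<close>] by (blast intro: order_trans)+
  have q: "Poly_Mapping.keys (cycle_chain q) \<subseteq> cells_on (set (cycle_labels q)) w' (cycle_dim q)"
    "cel_boundary (cycle_chain q) = 0"
    using cycle_chain_cycle[OF qc] cells_on_mono[OF \<open>w \<le> w'\<close>] by (blast intro: order_trans)+
  have P: "Poly_Mapping.keys ?P \<subseteq> cells_on (set (concat ws)) w' (Suc (comp_dim (Filter ws)))"
    using c(2) ws(2) by (intro keys_filter_product[OF cF]) (simp_all add: pq)
  have bd: "cel_boundary (?P \<odot> cycle_chain q) = comp_chain (Filter ws) \<odot> cycle_chain q"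
    using cel_boundary_append[OF symbol_dim_cells_on[OF P]] q(2) by (simp add: wheel_product_def)
  \<comment> \<open>The sign offsets the Leibniz sign from moving the boundary past
    \<open>p\<close>.\<close>
  let ?y = "frag_cmul ((-1) ^ cycle_dim p) (cycle_chain p \<odot> ?P \<odot> cycle_chain q)"
  have "Poly_Mapping.keys (cycle_chain p \<odot> ?P \<odot> cycle_chain q) \<subseteq>
    cells_on (set (cycle_labels p) \<union> (set (concat ws) \<union> set (cycle_labels q))) w'
      (cycle_dim p + (Suc (comp_dim (Filter ws)) + cycle_dim q))"
    using c(2) pq by (intro keys_frag_append_cells_on p q P) auto
  then have "Poly_Mapping.keys ?y \<subseteq> cells_on (set (cycle_labels c)) w' (Suc (cycle_dim c))"
    using keys_cmul pq by fastforce
  moreover have "cel_boundary ?y = cycle_chain c"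
    using cel_boundary_append[OF symbol_dim_cells_on[OF p(1)], where y = "?P \<odot> cycle_chain q"] p(2) bd
    by (simp add: cel_boundary_cmul pq cycle_chain_append flip: power_mult_distrib)
  ultimately show thesis by (rule that)
qed

section \<open>Classes in cellular homology\<close>

text \<open>The subgroup that occurs unnamed inside \<open>cel_homology\<close>, with the cycles as
  its carrier.\<close>

definition cycle_group :: "nat \<Rightarrow> nat \<Rightarrow> nat \<Rightarrow> cel_chain monoid" where
  "cycle_group n w d = subgroup_generated (free_Abelian_group (cells n w d)) (cel_cycles n w d)"

lemma subgroup_cel_cycles: "subgroup (cel_cycles n w d) (free_Abelian_group (cells n w d))"
proof (rule group.subgroupI[OF group_free_Abelian_group])
  show "cel_cycles n w d \<noteq> {}" by (auto simp: cel_cycles_def intro!: exI[of _ 0])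
next
  fix x assume "x \<in> cel_cycles n w d"
  then show "inv\<^bsub>free_Abelian_group (cells n w d)\<^esub> x \<in> cel_cycles n w d"
    using cel_boundary_cmul[of "-1" x] by (simp add: cel_cycles_def)
next
  fix x y assume "x \<in> cel_cycles n w d" "y \<in> cel_cycles n w d"
  then show "x \<otimes>\<^bsub>free_Abelian_group (cells n w d)\<^esub> y \<in> cel_cycles n w d"
    using keys_add[of x y] by (auto simp: cel_cycles_def cel_boundary_add)
qed (auto simp: cel_cycles_def)

lemma carrier_cycle_group: "carrier (cycle_group n w d) = cel_cycles n w d"
  unfolding cycle_group_def
  by (rule subgroup.carrier_subgroup_generated_subgroup[OF subgroup_cel_cycles])

lemma comm_group_cycle_group: "comm_group (cycle_group n w d)"
  unfolding cycle_group_def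
  by (rule group.abelian_subgroup_generated[OF group_free_Abelian_group abelian_free_Abelian_group])

lemma cel_boundaries_subset: "cel_boundaries n w d \<subseteq> cel_cycles n w d"
proof
  fix x assume "x \<in> cel_boundaries n w d"
  then obtain y where y: "Poly_Mapping.keys y \<subseteq> cells_on {1..n} w (Suc d)" "x = cel_boundary y"
    by (auto simp: cel_boundaries_def cells_eq_cells_on)
  then show "x \<in> cel_cycles n w d"
    using keys_cel_boundary[OF y(1)] cel_boundary_cel_boundary[OF y(1)]
    by (simp add: cel_cycles_def cells_eq_cells_on)
qed

lemma subgroup_cel_boundaries: "subgroup (cel_boundaries n w d) (cycle_group n w d)"
proof (rule group.subgroupI)
  show "group (cycle_group n w d)" using comm_group_cycle_group by (rule comm_group.axioms)
  show "cel_boundaries n w d \<subseteq> carrier (cycle_group n w d)"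
    by (simp add: carrier_cycle_group cel_boundaries_subset)
  have "0 \<in> cel_boundaries n w d"
    unfolding cel_boundaries_def by (rule image_eqI[of _ _ 0]) simp_all
  then show "cel_boundaries n w d \<noteq> {}" by blast
next
  fix x assume x: "x \<in> cel_boundaries n w d"
  then obtain y where y: "Poly_Mapping.keys y \<subseteq> cells n w (Suc d)" "x = cel_boundary y"
    by (auto simp: cel_boundaries_def)
  have cyc: "x \<in> cel_cycles n w d" using x cel_boundaries_subset by blast
  then have "x \<in> carrier (cycle_group n w d)" by (simp add: carrier_cycle_group)
  then have "inv\<^bsub>cycle_group n w d\<^esub> x = inv\<^bsub>free_Abelian_group (cells n w d)\<^esub> x"
    unfolding cycle_group_def by (intro group.inv_subgroup_generated) simp_all
  also have "\<dots> = - x" using cyc by (simp add: cel_cycles_def)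
  also have "\<dots> = cel_boundary (- y)" using cel_boundary_cmul[of "-1" y] y(2) by simp
  finally show "inv\<^bsub>cycle_group n w d\<^esub> x \<in> cel_boundaries n w d"
    using y(1) unfolding cel_boundaries_def by (intro image_eqI[of _ _ "- y"]) simp_all
next
  fix x y assume "x \<in> cel_boundaries n w d" "y \<in> cel_boundaries n w d"
  then obtain x' y' where "Poly_Mapping.keys x' \<subseteq> cells n w (Suc d)" "x = cel_boundary x'"
    "Poly_Mapping.keys y' \<subseteq> cells n w (Suc d)" "y = cel_boundary y'"
    by (auto simp: cel_boundaries_def)
  then show "x \<otimes>\<^bsub>cycle_group n w d\<^esub> y \<in> cel_boundaries n w d"
    using keys_add[of x' y'] unfolding cel_boundaries_def cycle_group_def
    by (intro image_eqI[of _ _ "x' + y'"]) (auto simp: cel_boundary_add)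
qed

lemma cel_homology_eq: "cel_homology n w d = cycle_group n w d Mod cel_boundaries n w d"
  by (simp add: cel_homology_def cycle_group_def)

lemma normal_cel_boundaries: "cel_boundaries n w d \<lhd> cycle_group n w d"
  using subgroup_cel_boundaries comm_group_cycle_group by (simp add: comm_group.normal_iff_subgroup)

lemma group_cel_homology: "group (cel_homology n w d)"
  unfolding cel_homology_eq by (rule normal.factorgroup_is_group[OF normal_cel_boundaries])

text \<open>Passing to a generated subgroup keeps the multiplication, so cosets taken in the chain
  group and in the cycle group are the same sets.\<close>

lemma cel_class_eq: "cel_class n w d z = cel_boundaries n w d #>\<^bsub>cycle_group n w d\<^esub> z"
  by (simp add: cel_class_def r_coset_def cycle_group_def)

lemma carrier_cel_homology: "carrier (cel_homology n w d) = cel_class n w d ` cel_cycles n w d"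
  by (auto simp: cel_homology_eq FactGroup_def RCOSETS_def cel_class_eq carrier_cycle_group)

lemma cel_class_eq_one_iff:
  assumes "z \<in> cel_cycles n w d"
  shows "cel_class n w d z = \<one>\<^bsub>cel_homology n w d\<^esub> \<longleftrightarrow> z \<in> cel_boundaries n w d"
proof -
  have G: "group (cycle_group n w d)" using comm_group_cycle_group by (rule comm_group.axioms)
  have z: "z \<in> carrier (cycle_group n w d)" using assms by (simp add: carrier_cycle_group)
  have "cel_boundaries n w d #>\<^bsub>cycle_group n w d\<^esub> z = cel_boundaries n w d \<longleftrightarrow> z \<in> cel_boundaries n w d"
    using group.coset_join2[OF G z subgroup_cel_boundaries] group.rcos_self[OF G z subgroup_cel_boundaries]
    by blast
  then show ?thesis by (simp add: cel_class_eq cel_homology_eq)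
qed

section \<open>Concatenations of wheels are not boundaries\<close>

text \<open>The exponent of the Koszul sign for sorting the blocks, a block of length k having
  degree k - 1. First entries serve as sorting keys, as disjoint nonempty blocks have different
  ones.\<close>

fun block_inversions :: "'a::linorder list list \<Rightarrow> nat" where
  "block_inversions [] = 0"
| "block_inversions (b # s) =
     (\<Sum>c\<leftarrow>s. if hd c < hd b then (length b - 1) * (length c - 1) else 0) + block_inversions s"

text \<open>Graded symmetric in the blocks, this is a cocycle because splitting a block along a set
  and along its complement gives opposite contributions. The value group \<open>unit \<Rightarrow>\<^sub>0 int\<close>
  is a copy of the integers that makes \<open>frag_extend\<close> available.\<close>

definition block_cochain :: "'a::linorder list list \<Rightarrow> 'a list list \<Rightarrow> (unit \<Rightarrow>\<^sub>0 int)" where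
  "block_cochain L s = (if mset s = mset L then frag_cmul ((-1) ^ block_inversions s) (frag_of ()) else 0)"

lemma block_inversions_swap:
  assumes "hd a \<noteq> hd b"
  shows "(-1 :: int) ^ block_inversions (u @ b # a # v) =
    (-1) ^ ((length a - 1) * (length b - 1)) * (-1) ^ block_inversions (u @ a # b # v)"
proof (induction u)
  case Nil
  let ?p = "(length a - 1) * (length b - 1)"
  have [simp]: "(-1 :: int) ^ ?p * (-1) ^ ?p = 1" by (simp flip: power_mult_distrib)
  from assms consider "hd a < hd b" | "hd b < hd a" by fastforce
  then show ?case
  proof cases
    case 1
    then show ?thesis by (simp add: power_add mult.commute mult.left_commute)
  next
    case 2
    have "block_inversions (a # b # v) = ?p + block_inversions (b # a # v)"
      using 2 by simp
    then show ?thesis by (simp only: power_add append_Nil mult.assoc[symmetric]) simp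
  qed
next
  case (Cons c u)
  have "(\<Sum>d\<leftarrow>u @ b # a # v. f d) = (\<Sum>d\<leftarrow>u @ a # b # v. f d)" for f :: "'a list \<Rightarrow> nat"
    by simp
  then show ?case
    using Cons by (simp add: power_add)
qed

lemma block_cochain_swap:
  assumes "hd a \<noteq> hd b"
  shows "block_cochain L (u @ b # a # v) =
    frag_cmul ((-1) ^ ((length a - 1) * (length b - 1))) (block_cochain L (u @ a # b # v))"
  using block_inversions_swap[OF assms, of u v] by (simp add: block_cochain_def add.commute add_mset_commute)

lemma block_cochain_block_boundary:
  assumes "distinct g"
  shows "frag_extend (\<lambda>t. block_cochain L (u @ t @ v)) (block_boundary g) = 0"
proof -
  let ?G = "set g"
  define h where "h = (\<lambda>A. frag_cmul ((-1) ^ (card A + crossings A g))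
    (block_cochain L (u @ elems_in A g # elems_out A g # v)))"
  have eq: "frag_extend (\<lambda>t. block_cochain L (u @ t @ v)) (block_boundary g) = sum h (proper_subsets ?G)"
    by (simp add: block_boundary_unshuffle[OF assms] frag_extend_sum frag_extend_cmul h_def comp_def)
  have anti: "h (?G - A) = - h A" if A: "A \<in> proper_subsets ?G" for A
  proof -
    let ?a = "elems_in A g" and ?b = "elems_out A g"
    have sub: "A \<noteq> {}" "A \<subset> ?G" using A by (auto simp: proper_subsets_def)
    have sets: "set ?a = A" "set ?b = ?G - A" using sub by auto
    have len: "length ?a = card A" "length ?b = card (?G - A)"
      using assms sets by (metis distinct_card distinct_filter)+
    have ne: "?a \<noteq> []" "?b \<noteq> []" using sets sub by force+
    then obtain p q where pq: "length ?a = Suc p" "length ?b = Suc q"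
      by (metis Suc_pred length_greater_0_conv)
    have "hd ?a \<in> A" "hd ?b \<in> ?G - A" using ne hd_in_set sets by blast+
    then have hd: "hd ?a \<noteq> hd ?b" by (metis DiffD2)
    have swap: "elems_in (?G - A) g = ?b" "elems_out (?G - A) g = ?a"
      by (auto intro!: filter_cong)
    have "crossings (?G - A) g = crossings (- A) g" by (rule crossings_cong) auto
    then have cr: "crossings A g + crossings (?G - A) g = Suc p * Suc q"
      using crossings_complement[of A g] pq by simp
    \<comment> \<open>The block lengths are p + 1 and q + 1: the cardinalities add up to p + q + 2,
      the crossings to (p + 1)(q + 1), and exchanging the blocks costs pq. The total is odd.\<close>
    have "(card (?G - A) + crossings (?G - A) g) + p * q + (card A + crossings A g) = 2 * (p * q + p + q + 1) + 1"
      using cr len pq by (simp add: algebra_simps)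
    then have "odd ((card (?G - A) + crossings (?G - A) g) + p * q + (card A + crossings A g))"
      by (metis odd_two_times_div_two_nat even_mult_iff even_add odd_one dvd_refl)
    then have "(-1 :: int) ^ (card (?G - A) + crossings (?G - A) g) * (-1) ^ (p * q) = - ((-1) ^ (card A + crossings A g))"
      unfolding power_add[symmetric] by (auto simp: minus_one_power_iff)
    then show ?thesis
      unfolding h_def swap block_cochain_swap[OF hd] by (simp add: pq)
  qed
  have "sum h (proper_subsets ?G) = sum (\<lambda>A. h (?G - A)) (proper_subsets ?G)"
    by (rule sum.reindex_bij_witness[where i = "\<lambda>A. ?G - A" and j = "\<lambda>A. ?G - A"])
      (auto simp: proper_subsets_def double_diff)
  also have "\<dots> = - sum h (proper_subsets ?G)"
    by (simp add: anti sum_negf)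
  finally have "sum h (proper_subsets ?G) + sum h (proper_subsets ?G) = 0"
    by (simp add: eq_neg_iff_add_eq_0)
  \<comment> \<open>The sum equals its own negative, and the value group has no 2-torsion.\<close>
  then have "frag_cmul 2 (sum h (proper_subsets ?G)) = 0"
    using frag_cmul_distrib[of 1 1 "sum h (proper_subsets ?G)"] by simp
  then show ?thesis by (simp add: eq)
qed

lemma block_cochain_symbol_boundary:
  assumes "distinct (concat s)"
  shows "frag_extend (\<lambda>t. block_cochain L (u @ t)) (symbol_boundary s) = 0"
  using assms
proof (induction s arbitrary: u)
  case (Cons g s)
  have 1: "frag_extend (\<lambda>t. block_cochain L (u @ t)) (x \<odot> frag_of s) =
      frag_extend (\<lambda>t. block_cochain L (u @ t @ s)) x" for x
    by (rule frag_induction[where S = UNIV and c = x]) (simp_all add: frag_append_diff frag_extend_diff)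
  have 2: "frag_extend (\<lambda>t. block_cochain L (u @ t)) (frag_of [g] \<odot> x) =
      frag_extend (\<lambda>t. block_cochain L ((u @ [g]) @ t)) x" for x
    by (rule frag_induction[where S = UNIV and c = x]) (simp_all add: frag_append_diff frag_extend_diff)
  show ?case
    using Cons.prems Cons.IH[of "u @ [g]"] block_cochain_block_boundary[of g L u s]
    by (simp only: symbol_boundary.simps bar_eq frag_extend_add frag_extend_cmul 1 2) simp
qed simp

lemma block_cochain_cel_boundary:
  assumes "Poly_Mapping.keys x \<subseteq> cells_on K w d"
  shows "frag_extend (block_cochain L) (cel_boundary x) = 0"
  using assms
proof (rule frag_induction)
  fix s assume "s \<in> cells_on K w d"
  then show "frag_extend (block_cochain L) (cel_boundary (frag_of s)) = 0"
    using block_cochain_symbol_boundary[of s L "[]"] by (simp add: cells_on_def)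
qed (simp_all add: cel_boundary_diff frag_extend_diff)

lemma lookup_block_append:
  "Poly_Mapping.lookup (as_block x \<odot> y) (g # s) = Poly_Mapping.lookup x g * Poly_Mapping.lookup y s"
proof (rule frag_induction[where S = UNIV and c = x])
  fix b
  show "Poly_Mapping.lookup (as_block (frag_of b) \<odot> y) (g # s) =
      Poly_Mapping.lookup (frag_of b) g * Poly_Mapping.lookup y s"
    by (rule frag_induction[where S = UNIV and c = y]) (auto simp: frag_append_diff lookup_minus)
qed (simp_all add: frag_append_diff as_block_def frag_extend_diff lookup_minus algebra_simps)

lemma lookup_wheels:
  assumes "[] \<notin> set L" "distinct (concat L)"
  shows "Poly_Mapping.lookup (cycle_chain (map Wheel L)) L = 1"
  using assms by (induction L) (auto simp: lookup_block_append lookup_wheel)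

lemma keys_wheels:
  "s \<in> Poly_Mapping.keys (cycle_chain (map Wheel L)) \<Longrightarrow> list_all2 (\<lambda>b v. set b = set v) s L"
proof (induction L arbitrary: s)
  case (Cons v L)
  then obtain t u where tu: "t \<in> Poly_Mapping.keys (as_block (wheel v))"
    "u \<in> Poly_Mapping.keys (cycle_chain (map Wheel L))" "s = t @ u"
    by (simp only: list.map cycle_chain_simps comp_chain.simps) (rule keys_frag_appendE)
  from tu(1) obtain g where g: "g \<in> Poly_Mapping.keys (wheel v)" "t = [g]"
    by (rule keys_as_blockE)
  then show ?case
    using Cons.IH[OF tu(2)] tu(3) mset_eq_setD[OF keys_wheel[OF g(1)]] by simp
qed (simp add: keys_frag_of)

text \<open>The cochain is supported on rearrangements of the list of blocks \<open>L\<close>. A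
  term of the chain has, position by position, the label sets of \<open>L\<close>; as these are
  disjoint and nonempty, only \<open>L\<close> itself is such a rearrangement. It has coefficient 1,
  whereas the cochain vanishes on boundaries.\<close>

lemma wheels_not_boundary:
  assumes L: "[] \<notin> set L" "distinct (concat L)"
    and y: "Poly_Mapping.keys y \<subseteq> cells_on K w d"
  shows "cel_boundary y \<noteq> cycle_chain (map Wheel L)"
proof
  let ?z = "cycle_chain (map Wheel L)"
  assume eq: "cel_boundary y = ?z"
  have unique: "s = L" if s: "s \<in> Poly_Mapping.keys ?z" "mset s = mset L" for s
  proof (rule nth_equalityI)
    have l2: "list_all2 (\<lambda>b v. set b = set v) s L" by (rule keys_wheels[OF s(1)])
    then show "length s = length L" by (rule list_all2_lengthD)
    fix i assume i: "i < length s"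
    have "s ! i \<in> set L" "L ! i \<in> set L"
      using i s(2) \<open>length s = length L\<close> by (metis mset_eq_setD nth_mem)+
    moreover have "set (s ! i) = set (L ! i)" using l2 i by (rule list_all2_nthD)
    moreover have "L ! i \<noteq> []" using calculation(2) L(1) by metis
    ultimately show "s ! i = L ! i"
      using L(2) unfolding distinct_concat_iff by (metis inf.idem set_empty)
  qed
  have "frag_extend (block_cochain L) ?z =
      (\<Sum>s\<in>Poly_Mapping.keys ?z. frag_cmul (Poly_Mapping.lookup ?z s) (block_cochain L s))"
    by (simp add: frag_extend_def)
  also have "\<dots> = (\<Sum>s\<in>{L}. frag_cmul (Poly_Mapping.lookup ?z s) (block_cochain L s))"
  proof (rule sum.mono_neutral_right)
    show "{L} \<subseteq> Poly_Mapping.keys ?z" using lookup_wheels[OF L] by (simp add: in_keys_iff)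
    show "\<forall>s\<in>Poly_Mapping.keys ?z - {L}. frag_cmul (Poly_Mapping.lookup ?z s) (block_cochain L s) = 0"
      using unique by (auto simp: block_cochain_def)
  qed simp
  also have "\<dots> \<noteq> 0"
    by (simp add: lookup_wheels[OF L] block_cochain_def)
  finally show False
    using block_cochain_cel_boundary[OF y, of L] eq by simp
qed

section \<open>Persistence of basic cycles\<close>

lemma basic_cycleD:
  assumes "basic_cycle n w c"
  shows "w \<ge> 1" "distinct (cycle_labels c)" "set (cycle_labels c) = {1..n}" "\<forall>x\<in>set c. comp_allowed w x"
  using assms unfolding basic_cycle_def concat_comp_wheels by blast+

lemma cycle_chain_in_cel_cycles:
  assumes "basic_cycle n w c" "w \<le> w'"
  shows "cycle_chain c \<in> cel_cycles n w' (cycle_dim c)"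
proof -
  note c = basic_cycleD[OF assms(1)]
  have "Poly_Mapping.keys (cycle_chain c) \<subseteq> cells_on {1..n} w' (cycle_dim c)"
    using cycle_chain_cycle[OF c(4,2)] cells_on_mono[OF assms(2)] unfolding c(3) by (blast intro: order_trans)
  then show ?thesis
    using cycle_chain_cycle[OF c(4,2)] by (simp add: cel_cycles_def cells_eq_cells_on)
qed

lemma iso_eq_one_iff:
  assumes "f \<in> iso G H" "group G" "group H" "x \<in> carrier G"
  shows "f x = \<one>\<^bsub>H\<^esub> \<longleftrightarrow> x = \<one>\<^bsub>G\<^esub>"
proof -
  have hom: "f \<in> hom G H" and inj: "inj_on f (carrier G)"
    using assms(1) by (auto simp: iso_def bij_betw_def)
  have "\<one>\<^bsub>G\<^esub> \<in> carrier G" using assms(2) by (simp add: group.is_monoid monoid.one_closed)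
  then have "f x = f \<one>\<^bsub>G\<^esub> \<longleftrightarrow> x = \<one>\<^bsub>G\<^esub>" by (rule inj_on_eq_iff[OF inj assms(4)])
  then show ?thesis by (simp only: hom_one[OF hom assms(2,3)])
qed

text \<open>Naturality moves the class to width w' on the cellular side, and an isomorphism reflects
  the identity. This removes the configuration spaces from the question.\<close>

lemma persists_iff:
  assumes \<Phi>: "cellular_identification \<Phi>" and c: "basic_cycle n w c" and w: "w \<le> w'"
  shows "persists \<Phi> n c w w' \<longleftrightarrow> cycle_chain c \<notin> cel_boundaries n w' (cycle_dim c)"
proof -
  let ?d = "cycle_dim c" and ?z = "cycle_chain c"
  have pos: "1 \<le> w" "1 \<le> w'" using basic_cycleD(1)[OF c] w by simp_all
  have z: "?z \<in> cel_cycles n w ?d" "?z \<in> cel_cycles n w' ?d"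
    using cycle_chain_in_cel_cycles[OF c] w by blast+
  have stab: "stab n w w' ?d (config_class \<Phi> n c w) = \<Phi> n w' ?d (cel_class n w' ?d ?z)"
    using \<Phi> z(1) pos w unfolding cellular_identification_def config_class_def by blast
  have iso: "\<Phi> n w' ?d \<in> iso (cel_homology n w' ?d) (config_homology n w' ?d)"
    using \<Phi> pos unfolding cellular_identification_def by blast
  have "cel_class n w' ?d ?z \<in> carrier (cel_homology n w' ?d)"
    using z(2) by (simp add: carrier_cel_homology)
  then have "\<Phi> n w' ?d (cel_class n w' ?d ?z) = \<one>\<^bsub>config_homology n w' ?d\<^esub> \<longleftrightarrow>
      cel_class n w' ?d ?z = \<one>\<^bsub>cel_homology n w' ?d\<^esub>"
    by (intro iso_eq_one_iff[OF iso group_cel_homology]) simp_all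
  then show ?thesis
    by (simp add: persists_def stab cel_class_eq_one_iff[OF z(2)])
qed

lemma filter_not_persists:
  assumes "cellular_identification \<Phi>" "basic_cycle n w c" "w \<le> w'"
    and "Filter ws \<in> set c" "length (concat ws) \<le> w'"
  shows "\<not> persists \<Phi> n c w w'"
proof -
  note c = basic_cycleD[OF assms(2)]
  obtain y where "Poly_Mapping.keys y \<subseteq> cells_on {1..n} w' (Suc (cycle_dim c))" "cel_boundary y = cycle_chain c"
    using filter_cycle_bounds[OF c(4,2) assms(4,5)] unfolding c(3) .
  then have "cycle_chain c \<in> cel_boundaries n w' (cycle_dim c)"
    unfolding cel_boundaries_def cells_eq_cells_on by (intro image_eqI[of _ _ y]) simp_all
  then show ?thesis using persists_iff[OF assms(1-3)] by simp
qed

lemma wheels_persist: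
  assumes "cellular_identification \<Phi>" "basic_cycle n w c" "w \<le> w'" and nf: "\<And>ws. Filter ws \<notin> set c"
  shows "persists \<Phi> n c w w'"
proof -
  note c = basic_cycleD[OF assms(2)]
  define L where "L = map (\<lambda>x. hd (comp_wheels x)) c"
  have "Wheel (hd (comp_wheels x)) = x" if "x \<in> set c" for x
    using that nf by (cases x rule: component.exhaust) auto
  then have L: "c = map Wheel L" unfolding L_def by (simp add: map_idI)
  have "cycle_labels (map Wheel L) = concat L" by (induction L) simp_all
  then have d: "distinct (concat L)" using c(2) L by simp
  have ne: "[] \<notin> set L"
  proof
    assume "[] \<in> set L"
    then have "Wheel [] \<in> set c" unfolding L by force
    then show False using c(4) by fastforce
  qed
  have "cycle_chain c \<notin> cel_boundaries n w' (cycle_dim c)"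
  proof
    assume "cycle_chain c \<in> cel_boundaries n w' (cycle_dim c)"
    then obtain y where "Poly_Mapping.keys y \<subseteq> cells_on {1..n} w' (Suc (cycle_dim c))"
      "cel_boundary y = cycle_chain c"
      unfolding cel_boundaries_def cells_eq_cells_on by auto
    then show False using wheels_not_boundary[OF ne d] L by simp
  qed
  then show ?thesis using persists_iff[OF assms(1-3)] by simp
qed

text \<open>A filter on \<open>r \<ge> 2\<close> wheels with \<open>k\<close> disks has \<open>k \<ge> 2 (k - w)\<close>.\<close>

lemma filter_length_le:
  assumes "comp_allowed w (Filter ws)"
  shows "length (concat ws) \<le> 2 * w"
proof -
  let ?k = "length (concat ws)"
  have "\<exists>u v ws'. ws = u # v # ws'" using assms by (cases ws; cases "tl ws") auto
  then obtain u v ws' where ws: "ws = u # v # ws'" by blast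
  have "?k - w \<le> length u" "?k - w \<le> length v" using assms by (simp_all add: ws)
  moreover have "length u + length v \<le> ?k" unfolding ws by simp
  ultimately show ?thesis by linarith
qed

lemma born_persists_or_dies:
  assumes \<Phi>: "cellular_identification \<Phi>" and born: "born_at n c w"
  shows "(\<forall>w'>w. persists \<Phi> n c w w') \<or> (\<exists>d\<le>2 * w. dies_at \<Phi> n c d)"
proof (cases "\<exists>ws. Filter ws \<in> set c")
  case False
  then show ?thesis using wheels_persist[OF \<Phi>, of n w c] born by (simp add: born_at_def)
next
  case True
  then obtain ws where ws: "Filter ws \<in> set c" ..
  have c: "basic_cycle n w c" using born by (simp add: born_at_def)
  then have allowed: "comp_allowed w (Filter ws)" using basic_cycleD(4) ws by blast
  let ?k = "length (concat ws)"
  let ?P = "\<lambda>d. w < d \<and> \<not> persists \<Phi> n c w d"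
  have k: "?P ?k" using allowed filter_not_persists[OF \<Phi> c _ ws] by simp
  \<comment> \<open>The least width with vanishing class is the death required by
    \<open>dies_at\<close>; the number k of disks in one filter is such a width and is at most
    2w.\<close>
  define d where "d = (LEAST d. ?P d)"
  have d: "?P d" unfolding d_def by (rule LeastI[of ?P, OF k])
  have "d \<le> ?k" unfolding d_def by (rule Least_le[of ?P, OF k])
  moreover have "?k \<le> 2 * w" by (rule filter_length_le[OF allowed])
  moreover have "persists \<Phi> n c w v" if "w < v" "v < d" for v
    using not_less_Least[of v ?P, folded d_def, OF that(2)] that(1) by simp
  ultimately have "d \<le> 2 * w" "dies_at \<Phi> n c d"
    using d born unfolding dies_at_def by (simp, blast)
  then show ?thesis by blast
qed

section \<open>Low-dimensional homology\<close>

text \<open>A block with more than \<open>w\<close> elements needs a cell of dimension at least \<open>w\<close>.\<close>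

lemma cells_stable:
  assumes "d < w" "w \<le> w'"
  shows "cells n w d = cells n w' d"
proof -
  have "length b \<le> w" if "s \<in> cells_on {1..n} w' d" "b \<in> set s" for s b
  proof -
    have "length b - 1 \<le> symbol_dim s"
      unfolding symbol_dim_def using that(2) by (intro member_le_sum_list) auto
    then show ?thesis using that(1) assms(1) by (simp add: cells_on_def)
  qed
  then have "cells_on {1..n} w' d \<subseteq> cells_on {1..n} w d" unfolding cells_on_def by blast
  then show ?thesis using cells_on_mono[OF assms(2)] by (auto simp: cells_eq_cells_on)
qed

text \<open>With j + 2 at most w, neither the j-cells nor the (j + 1)-cells change, so both the
  cycles and the boundaries in degree j are the same. On the carrier the stabilisation map is then
  one identification composed with the inverse of the other.\<close>

lemma stab_iso:
  assumes \<Phi>: "cellular_identification \<Phi>" and j: "j + 2 \<le> w" and w: "w \<le> w'"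
  shows "stab n w w' j \<in> iso (config_homology n w j) (config_homology n w' j)"
proof -
  have cells: "cells n w j = cells n w' j" "cells n w (Suc j) = cells n w' (Suc j)"
    using cells_stable w j by simp_all
  have hom: "cel_homology n w j = cel_homology n w' j" "cel_class n w j = cel_class n w' j"
    by (simp_all add: fun_eq_iff cel_homology_def cel_class_def cel_cycles_def cel_boundaries_def cells)
  have pos: "1 \<le> w" "1 \<le> w'" using j w by simp_all
  have iso: "\<Phi> n w j \<in> iso (cel_homology n w j) (config_homology n w j)"
    using \<Phi> pos(1) unfolding cellular_identification_def by blast
  have "\<Phi> n w' j \<in> iso (cel_homology n w' j) (config_homology n w' j)"
    using \<Phi> pos(2) unfolding cellular_identification_def by blast
  then have iso': "\<Phi> n w' j \<in> iso (cel_homology n w j) (config_homology n w' j)"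
    by (simp only: hom(1))
  let ?inv = "inv_into (carrier (cel_homology n w j)) (\<Phi> n w j)"
  have inv: "?inv \<in> iso (config_homology n w j) (cel_homology n w j)"
    using group.iso_set_sym[OF group_cel_homology iso] .
  have "\<Phi> n w' j \<circ> ?inv \<in> iso (config_homology n w j) (config_homology n w' j)"
    by (rule iso_set_trans[OF inv iso'])
  moreover have "stab n w w' j x = (\<Phi> n w' j \<circ> ?inv) x" if x: "x \<in> carrier (config_homology n w j)" for x
  proof -
    have "?inv x \<in> carrier (cel_homology n w j)" using inv x by (auto simp: iso_def hom_def)
    then obtain z where z: "z \<in> cel_cycles n w j" "?inv x = cel_class n w j z"
      by (auto simp: carrier_cel_homology)
    have "\<Phi> n w j (?inv x) = x"
      using iso x by (intro f_inv_into_f) (auto simp: iso_def bij_betw_def)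
    then have "stab n w w' j x = stab n w w' j (\<Phi> n w j (cel_class n w j z))" using z(2) by simp
    also have "\<dots> = \<Phi> n w' j (cel_class n w' j z)"
      using \<Phi> z(1) pos(1) w unfolding cellular_identification_def by blast
    finally show ?thesis by (simp add: z(2) hom(2))
  qed
  ultimately show ?thesis
    by (rule group.iso_eq[OF group_relative_homology_group])
qed

section \<open>Counting basic cycles\<close>

definition singles :: "nat list \<Rightarrow> component list"
  where "singles xs = map (\<lambda>a. Wheel [a]) xs"

lemma singles_simps [simp]:
  "singles [] = []" "singles (x # xs) = Wheel [x] # singles xs"
  "singles xs = [] \<longleftrightarrow> xs = []"
  by (simp_all add: singles_def)

lemma cycle_labels_singles [simp]: "cycle_labels (singles xs) = xs"
  by (induction xs) simp_all

lemma cycle_dim_singles [simp]: "cycle_dim (singles xs) = 0"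
  by (induction xs) simp_all

definition descending :: "nat set \<Rightarrow> nat list"
  where "descending S = rev (sorted_list_of_set S)"

lemma set_descending [simp]: "finite S \<Longrightarrow> set (descending S) = S"
  and distinct_descending [simp]: "distinct (descending S)"
  by (simp_all add: descending_def)

lemma sorted_descending: "sorted_wrt (>) (descending S)"
  by (simp add: descending_def sorted_wrt_rev)

lemma descending_unique:
  assumes "sorted_wrt (>) xs"
  shows "xs = descending (set xs)"
proof -
  have "sorted_wrt (<) (rev xs)" using assms by (simp add: sorted_wrt_rev)
  then have "rev xs = sorted_list_of_set (set (rev xs))"
    by (simp add: strict_sorted_equal)
  then show ?thesis by (simp add: descending_def rev_swap)
qed

lemma adjacent_singles: "adjacent_ok (Wheel [a]) (Wheel [b]) \<longleftrightarrow> b < a"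
  by (simp add: ranks_above_def largest_def)

text \<open>If no wheel of a filter is a single disk, then nothing but smaller single disks can follow a
  single disk.\<close>

lemma singles_at_end:
  assumes "successively adjacent_ok c"
    and "\<And>v. Wheel v \<in> set c \<Longrightarrow> v \<noteq> []"
    and "\<And>ws v. Filter ws \<in> set c \<Longrightarrow> v \<in> set ws \<Longrightarrow> length v \<ge> 2"
  shows "\<exists>p xs. c = p @ singles xs \<and> sorted_wrt (>) xs \<and> (\<forall>a. Wheel [a] \<notin> set p)"
  using assms
proof (induction c)
  case Nil
  show ?case by (intro exI[of _ "[]"]) simp
next
  case (Cons x c)
  have "successively adjacent_ok c" using Cons.prems(1) by (cases c) simp_all
  then obtain p xs where c: "c = p @ singles xs" "sorted_wrt (>) xs" "\<forall>a. Wheel [a] \<notin> set p"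
    using Cons by (metis list.set_intros(2))
  show ?case
  proof (cases "\<exists>a. x = Wheel [a]")
    case False
    then show ?thesis using c by (intro exI[of _ "x # p"] exI[of _ xs]) auto
  next
    case True
    then obtain a where a: "x = Wheel [a]" ..
    \<comment> \<open>A component right after a single disk would have to be, or contain as its
      lowest-ranking wheel, a single disk; \<open>p\<close> starts with neither kind.\<close>
    have "p = []"
    proof (rule ccontr)
      assume "p \<noteq> []"
      then obtain y p' where p: "p = y # p'" by (cases p) auto
      then have adj: "adjacent_ok (Wheel [a]) y" using Cons.prems(1) c(1) a by simp
      show False
      proof (cases y rule: component.exhaust)
        case (Wheel v)
        then have "v \<noteq> []" "length v \<le> 1"
          using Cons.prems(2)[of v] c(1) p adj by (auto simp: ranks_above_def)
        then obtain b where "v = [b]" by (cases v) auto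
        then show False using c(3) p Wheel by auto
      next
        case (Filter ws)
        then obtain v where "v \<in> set ws" "length v \<le> 1"
          using adj by (auto simp: lowest_ranking_def ranks_above_def)
        then show False using Cons.prems(3)[of ws v] c(1) p Filter by simp
      qed
    qed
    have "sorted_wrt (>) (a # xs)"
    proof (cases xs)
      case (Cons b ys)
      then have "b < a"
        using Cons.prems(1) c(1) a \<open>p = []\<close> adjacent_singles by simp
      then show ?thesis using Cons c(2) by fastforce
    qed simp
    then show ?thesis using a c(1) \<open>p = []\<close> by (intro exI[of _ "[]"] exI[of _ "a # xs"]) simp
  qed
qed

lemma successively_adjacent_ok: "basic_cycle n w c \<Longrightarrow> successively adjacent_ok c"
  by (simp add: basic_cycle_def successively_conv_nth)

section \<open>Polynomial upper bound for cycles without filters on w + 1 disks\<close>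

definition lists_upto :: "'a set \<Rightarrow> nat \<Rightarrow> 'a list set"
  where "lists_upto A m = {xs. set xs \<subseteq> A \<and> length xs \<le> m}"

lemma finite_lists_upto [simp]: "finite A \<Longrightarrow> finite (lists_upto A m)"
  by (simp add: lists_upto_def finite_lists_length_le)

lemma card_lists_upto_le:
  assumes "finite A"
  shows "card (lists_upto A m) \<le> Suc (card A) ^ m"
proof -
  have "(\<Sum>i\<le>m. k ^ i) \<le> Suc k ^ m" for k :: nat
  proof (induction m)
    case (Suc m)
    have "k ^ Suc m \<le> k * Suc k ^ m" by (simp add: power_mono)
    with Suc.IH show ?case
      unfolding sum.atMost_Suc power_Suc[of "Suc k"] mult_Suc by (rule add_mono)
  qed simp
  then show ?thesis using assms by (simp add: lists_upto_def card_lists_length_le)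
qed

definition components_upto :: "nat \<Rightarrow> nat \<Rightarrow> component set" where
  "components_upto n m = Wheel ` lists_upto {1..n} m \<union> Filter ` lists_upto (lists_upto {1..n} m) m"

lemma finite_components_upto [simp]: "finite (components_upto n m)"
  by (simp add: components_upto_def)

text \<open>The exponent Suc m * m counts lists of at most m wheels, and the summand 2 absorbs two
  doublings. The base n + 2 is at least 2 even for n = 0, so that one extra factor pays for a
  doubling.\<close>

lemma card_components_upto_le: "Suc (card (components_upto n m)) \<le> (n + 2) ^ (Suc m * m + 2)"
proof -
  let ?N = "n + 2"
  have L: "card (lists_upto {1..n} m) \<le> Suc n ^ m"
    using card_lists_upto_le[of "{1..n}" m] by simp
  have pos: "1 \<le> ?N ^ k" for k by (rule one_le_power) simp
  have "Suc n ^ m \<le> ?N ^ m" by (rule power_mono) simp_all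
  then have "Suc (card (lists_upto {1..n} m)) \<le> ?N ^ m + ?N ^ m"
    using L pos[of m] by linarith
  also have "\<dots> \<le> ?N ^ Suc m" by simp
  finally have S: "Suc (card (lists_upto {1..n} m)) \<le> ?N ^ Suc m" .
  have "card (lists_upto (lists_upto {1..n} m) m) \<le> Suc (card (lists_upto {1..n} m)) ^ m"
    by (rule card_lists_upto_le) simp
  also have "\<dots> \<le> (?N ^ Suc m) ^ m" using S by (rule power_mono) simp
  also have "\<dots> = ?N ^ (Suc m * m)" by (simp only: power_mult)
  finally have F: "card (lists_upto (lists_upto {1..n} m) m) \<le> ?N ^ (Suc m * m)" .
  have "Suc m \<le> Suc m * m + 1" by (cases m) simp_all
  then have "?N ^ Suc m \<le> ?N ^ (Suc m * m + 1)" by (rule power_increasing) simp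
  moreover have "?N ^ (Suc m * m) \<le> ?N ^ (Suc m * m + 1)" by (rule power_increasing) simp_all
  moreover have "card (components_upto n m) \<le> card (lists_upto {1..n} m) + card (lists_upto (lists_upto {1..n} m) m)"
    unfolding components_upto_def
    by (rule order_trans[OF card_Un_le add_mono]) (auto intro: card_image_le)
  ultimately have "Suc (card (components_upto n m)) \<le> ?N ^ (Suc m * m + 1) + ?N ^ (Suc m * m + 1)"
    using S F by linarith
  also have "\<dots> \<le> ?N ^ (Suc m * m + 2)" by simp
  finally show ?thesis .
qed

lemma length_le_concat: "[] \<notin> set ws \<Longrightarrow> length ws \<le> length (concat ws)"
proof (induction ws)
  case (Cons v ws)
  then show ?case by (cases v) auto
qed simp

lemma length_member_le_concat: "v \<in> set ws \<Longrightarrow> length v \<le> length (concat ws)"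
  by (induction ws) auto

lemma component_in_components_upto:
  assumes "comp_allowed w x" "set (comp_labels x) \<subseteq> {1..n}" "length (comp_labels x) \<le> m"
  shows "x \<in> components_upto n m"
proof (cases x rule: component.exhaust)
  case (Wheel as)
  then show ?thesis using assms by (auto simp: components_upto_def lists_upto_def)
next
  case (Filter ws)
  have "length ws \<le> m" using assms Filter length_le_concat[of ws] by simp
  moreover have "v \<in> lists_upto {1..n} m" if "v \<in> set ws" for v
    using that assms(2,3) Filter length_member_le_concat[OF that] by (auto simp: lists_upto_def)
  ultimately have "ws \<in> lists_upto (lists_upto {1..n} m) m"
    unfolding lists_upto_def[of "lists_upto {1..n} m"] by blast
  then show ?thesis unfolding components_upto_def Filter by blast
qed

lemma set_comp_labels_subset: "x \<in> set c \<Longrightarrow> set (comp_labels x) \<subseteq> set (cycle_labels c)"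
  by (auto simp: cycle_labels_def)

text \<open>Every component carries a label, so there are at most n components. Finiteness matters
  because \<open>card\<close> of an infinite set is 0.\<close>

lemma finite_basic_cycles: "finite (basic_cycles n w j)"
proof (rule finite_subset)
  show "basic_cycles n w j \<subseteq> lists_upto (components_upto n n) n"
  proof
    fix c assume "c \<in> basic_cycles n w j"
    then have "basic_cycle n w c" by (simp add: basic_cycles_def)
    note c = basic_cycleD(2-4)[OF this]
    have len: "length (cycle_labels c) = n"
      using c(1,2) by (metis card_atLeastAtMost diff_Suc_1 distinct_card)
    have "comp_labels x \<noteq> []" if "x \<in> set c" for x
    proof -
      have "comp_allowed w x" using c(3) that by blast
      then show ?thesis
      proof (cases x rule: component.exhaust)
        case (Filter ws)
        then have "0 < length (concat ws)"
          using \<open>comp_allowed w x\<close> by (simp del: length_greater_0_conv)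
        then show ?thesis by (simp only: length_greater_0_conv Filter comp_labels_simps not_False_eq_True)
      qed simp
    qed
    then have "[] \<notin> set (map comp_labels c)" unfolding set_map by (metis imageE)
    then have "length c \<le> n" using length_le_concat[of "map comp_labels c"] len by (simp add: cycle_labels_def)
    moreover have "x \<in> components_upto n n" if x: "x \<in> set c" for x
    proof (rule component_in_components_upto)
      show "comp_allowed w x" using c(3) x by blast
      show "set (comp_labels x) \<subseteq> {1..n}" using set_comp_labels_subset[OF x] c(2) by simp
      show "length (comp_labels x) \<le> n"
        using length_member_le_concat[of "comp_labels x" "map comp_labels c"] x len by (simp add: cycle_labels_def)
    qed
    ultimately show "c \<in> lists_upto (components_upto n n) n" by (auto simp: lists_upto_def)
  qed
qed simp

text \<open>A filter at width w has at least w + 1 disks, and one with exactly w + 1 bounds at width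
  w + 1. All basic cycles that persist one step therefore lie in this set.\<close>

definition without_minimal_filters :: "nat \<Rightarrow> nat \<Rightarrow> nat \<Rightarrow> component list set" where
  "without_minimal_filters n w j =
     {c \<in> basic_cycles n w j. \<forall>ws. Filter ws \<in> set c \<longrightarrow> length (concat ws) \<noteq> w + 1}"

text \<open>Such a cycle is recovered from its part before the final single disks, because these are
  the missing labels in descending order. That part has at most j components, each of positive
  dimension and with at most j + 2 labels.\<close>

lemma card_without_minimal_filters_le:
  "card (without_minimal_filters n w j) \<le> (n + 2) ^ ((Suc (j + 2) * (j + 2) + 2) * j)"
proof -
  let ?m = "j + 2"
  let ?P = "lists_upto (components_upto n ?m) j"
  let ?complete = "\<lambda>p. p @ singles (descending ({1..n} - set (cycle_labels p)))"
  have "c \<in> ?complete ` ?P" if "c \<in> without_minimal_filters n w j" for c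
  proof -
    have bc: "basic_cycle n w c" and dim: "cycle_dim c = j"
      and nomin: "\<And>ws. Filter ws \<in> set c \<Longrightarrow> length (concat ws) \<noteq> w + 1"
      using that by (auto simp: without_minimal_filters_def basic_cycles_def)
    note c = basic_cycleD[OF bc]
    have big: "length (concat ws) \<ge> w + 2" if "Filter ws \<in> set c" for ws
    proof -
      have "comp_allowed w (Filter ws)" using c(4) that by blast
      then show ?thesis using nomin[OF that] by simp
    qed
    have long: "length v \<ge> 2" if "Filter ws \<in> set c" "v \<in> set ws" for ws v
    proof -
      have "comp_allowed w (Filter ws)" using c(4) that(1) by blast
      then have "length (concat ws) - w \<le> length v" using that(2) by simp
      then show ?thesis using big[OF that(1)] by linarith
    qed
    have "v \<noteq> []" if "Wheel v \<in> set c" for v using c(4) that by fastforce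
    then have "\<exists>p xs. c = p @ singles xs \<and> sorted_wrt (>) xs \<and> (\<forall>a. Wheel [a] \<notin> set p)"
      by (rule singles_at_end[OF successively_adjacent_ok[OF bc]]) (use long in blast)+
    then obtain p xs where p: "c = p @ singles xs" "sorted_wrt (>) xs" "\<forall>a. Wheel [a] \<notin> set p"
      by blast
    have "set xs = {1..n} - set (cycle_labels p)"
      using c(2,3) p(1) by auto
    then have "c = ?complete p"
      using p(1) descending_unique[OF p(2)] by simp
    moreover have "p \<in> ?P"
    proof -
      have dimp: "cycle_dim p = j" using dim p(1) by simp
      \<comment> \<open>A wheel in \<open>p\<close> has at least two disks and a filter at least w +
        2, hence three; so each uses up part of the dimension j.\<close>
      have pos: "1 \<le> comp_dim x \<and> length (comp_labels x) \<le> comp_dim x + 2" if x: "x \<in> set p" for x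
      proof (cases x rule: component.exhaust)
        case (Wheel v)
        have "comp_allowed w x" using c(4) p(1) x by simp
        then have "v \<noteq> []" using Wheel by simp
        moreover have "v \<noteq> [a]" for a using p(3) x Wheel by blast
        ultimately have "length v \<ge> 2" by (cases v; cases "tl v") auto
        then show ?thesis by (simp add: Wheel, linarith)
      next
        case (Filter ws)
        then have "length (concat ws) \<ge> w + 2" using big p(1) x by simp
        then show ?thesis using c(1) by (simp add: Filter, linarith)
      qed
      have dim_le: "comp_dim x \<le> j" if "x \<in> set p" for x
        using that dimp member_le_sum_list[of "comp_dim x" "map comp_dim p"] by (simp add: cycle_dim_def)
      have "(\<Sum>x\<leftarrow>p. 1) \<le> (\<Sum>x\<leftarrow>p. comp_dim x)"
        using pos by (intro sum_list_mono) blast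
      then have "length p \<le> j" using dimp by (simp add: cycle_dim_def sum_list_triv)
      moreover have "x \<in> components_upto n ?m" if x: "x \<in> set p" for x
      proof (rule component_in_components_upto)
        show "comp_allowed w x" using c(4) p(1) x by simp
        show "set (comp_labels x) \<subseteq> {1..n}"
          using set_comp_labels_subset[of x c] c(3) p(1) x by simp
        show "length (comp_labels x) \<le> ?m" using pos[OF x] dim_le[OF x] by linarith
      qed
      ultimately show ?thesis by (auto simp: lists_upto_def)
    qed
    ultimately show ?thesis by (rule image_eqI)
  qed
  then have "card (without_minimal_filters n w j) \<le> card (?complete ` ?P)"
    by (intro card_mono) auto
  also have "\<dots> \<le> card ?P" by (rule card_image_le) simp
  also have "\<dots> \<le> Suc (card (components_upto n ?m)) ^ j"
    by (rule card_lists_upto_le) simp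
  also have "\<dots> \<le> ((n + 2) ^ (Suc ?m * ?m + 2)) ^ j"
    using card_components_upto_le by (rule power_mono) simp
  finally show ?thesis by (simp only: power_mult)
qed

section \<open>Exponential lower bound for all basic cycles\<close>

fun pair_wheels :: "nat \<Rightarrow> nat \<Rightarrow> component list" where
  "pair_wheels b 0 = []"
| "pair_wheels b (Suc t) = Wheel [b + 2 * t + 2, b + 2 * t + 1] # pair_wheels b t"

lemma pair_wheels_labels:
  "distinct (cycle_labels (pair_wheels b t)) \<and> set (cycle_labels (pair_wheels b t)) = {b + 1..b + 2 * t}"
proof (induction t)
  case (Suc t)
  have "{b + 1..b + 2 * Suc t} = {b + 2 * t + 2, b + 2 * t + 1} \<union> {b + 1..b + 2 * t}" by auto
  then show ?case using Suc by simp
qed simp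

lemma cycle_dim_pair_wheels [simp]: "cycle_dim (pair_wheels b t) = t"
  by (induction t) simp_all

lemma pair_wheelsE:
  assumes "x \<in> set (pair_wheels b t)"
  obtains a where "x = Wheel [Suc a, a]"
  using assms by (induction t) auto

lemma successively_pair_wheels: "successively adjacent_ok (pair_wheels b t)"
proof (induction t)
  case (Suc t)
  then show ?case by (cases t) (auto simp: ranks_above_def largest_def)
qed simp

lemma successively_singles: "sorted_wrt (>) xs \<Longrightarrow> successively adjacent_ok (singles xs)"
proof (induction xs)
  case (Cons x xs)
  then show ?case by (cases xs) (auto simp: ranks_above_def largest_def)
qed simp

text \<open>The interval is half open, so the labels are 1 up to w + 1. With k = w + 1 disks, the
  condition k - w = 1 admits wheels on one disk.\<close>

definition minimal_filter :: "nat \<Rightarrow> component"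
  where "minimal_filter w = Filter (map (\<lambda>i. [i]) [1..<w + 2])"

text \<open>The filter on the disks \<open>1, \<dots>, w + 1\<close> contains the lowest-ranking wheel of all, so each of the
  remaining single disks may be placed on either side of it.\<close>

definition split_cycle :: "nat \<Rightarrow> nat \<Rightarrow> nat \<Rightarrow> nat set \<Rightarrow> component list" where
  "split_cycle n w t S = singles (descending S) @ minimal_filter w # pair_wheels (w + 1) t
     @ singles (descending ({w + 2 + 2 * t..n} - S))"

lemma comp_labels_minimal_filter [simp]: "comp_labels (minimal_filter w) = [1..<w + 2]"
proof -
  have "concat (map (\<lambda>i. [i]) xs) = xs" for xs :: "nat list" by (induction xs) simp_all
  then show ?thesis by (simp add: minimal_filter_def del: upt_Suc)
qed

lemma comp_allowed_minimal_filter: "w \<ge> 1 \<Longrightarrow> comp_allowed w (minimal_filter w)"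
  using comp_labels_minimal_filter[of w] unfolding minimal_filter_def comp_labels_simps
  by (auto simp del: upt_Suc)

lemma comp_dim_minimal_filter: "comp_dim (minimal_filter w) = w - 1"
  using comp_labels_minimal_filter[of w] unfolding minimal_filter_def comp_labels_simps
  by (simp del: upt_Suc)

lemma adjacent_minimal_filter:
  assumes "a > 1"
  shows "adjacent_ok (Wheel [a]) (minimal_filter w)"
  unfolding minimal_filter_def adjacent_ok.simps
proof (intro exI conjI)
  show "lowest_ranking [1] (map (\<lambda>i. [i]) [1..<w + 2])"
    by (auto simp: lowest_ranking_def ranks_above_def largest_def simp del: upt_Suc)
  show "ranks_above [a] [1]"
    using assms by (simp add: ranks_above_def largest_def)
qed

lemma successively_split_cycle:
  assumes "S \<subseteq> {w + 2 + 2 * t..n}"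
  shows "successively adjacent_ok (split_cycle n w t S)"
proof -
  let ?T = "{w + 2 + 2 * t..n} - S"
  have fin: "finite S" using assms by (rule finite_subset) simp
  have end_pairs: "adjacent_ok (last (pair_wheels (w + 1) t)) (hd (singles (descending ?T)))"
    if ne: "pair_wheels (w + 1) t \<noteq> []" "singles (descending ?T) \<noteq> []"
  proof -
    obtain a where "last (pair_wheels (w + 1) t) = Wheel [Suc a, a]"
      using pair_wheelsE[OF last_in_set[OF ne(1)]] .
    moreover obtain b xs where "descending ?T = b # xs" using ne(2) by (cases "descending ?T") auto
    ultimately show ?thesis by (simp add: ranks_above_def)
  qed
  have "successively adjacent_ok (pair_wheels (w + 1) t @ singles (descending ?T))"
    using end_pairs by (auto simp: successively_append_iff successively_pair_wheels
        successively_singles sorted_descending)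
  then have "successively adjacent_ok (minimal_filter w # pair_wheels (w + 1) t @ singles (descending ?T))"
    by (cases "pair_wheels (w + 1) t @ singles (descending ?T)") (auto simp: minimal_filter_def)
  moreover have "adjacent_ok (last (singles (descending S))) (minimal_filter w)"
    if "singles (descending S) \<noteq> []"
  proof -
    have ne: "descending S \<noteq> []" using that by simp
    then have "last (descending S) \<in> S" using last_in_set[OF ne] fin by simp
    then have "last (descending S) > 1" using assms by auto
    moreover have "last (singles (descending S)) = Wheel [last (descending S)]"
      using ne by (simp add: singles_def last_map)
    ultimately show ?thesis using adjacent_minimal_filter by simp
  qed
  ultimately show ?thesis
    unfolding split_cycle_def
    by (auto simp: successively_append_iff successively_singles sorted_descending)
qed

lemma split_cycle_basic:
  assumes w: "w \<ge> 1" "w \<ge> 2 \<or> t = 0" and n: "w + 1 + 2 * t \<le> n" and S: "S \<subseteq> {w + 2 + 2 * t..n}"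
  shows "split_cycle n w t S \<in> basic_cycles n w (w - 1 + t)"
proof -
  let ?T = "{w + 2 + 2 * t..n} - S"
  have fin: "finite S" using S by (rule finite_subset) simp
  have labels: "cycle_labels (split_cycle n w t S) =
      descending S @ [1..<w + 2] @ cycle_labels (pair_wheels (w + 1) t) @ descending ?T"
    by (simp add: split_cycle_def del: upt_Suc)
  have "{1..n} = S \<union> ({1..<w + 2} \<union> ({w + 1 + 1..w + 1 + 2 * t} \<union> ?T))"
    using S n by auto
  then have "set (cycle_labels (split_cycle n w t S)) = {1..n}"
    using fin pair_wheels_labels[of "w + 1" t] unfolding labels by (simp del: upt_Suc)
  moreover have "distinct (cycle_labels (split_cycle n w t S))"
    using fin pair_wheels_labels[of "w + 1" t] S unfolding labels by (auto simp del: upt_Suc)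
  moreover have comp: "comp_allowed w x \<and> (\<forall>v\<in>set (comp_wheels x). hd v = largest v) \<and>
      (\<forall>ws. x = Filter ws \<longrightarrow> sorted_wrt (\<lambda>u v. largest u < largest v) ws)"
    if x: "x \<in> set (split_cycle n w t S)" for x
  proof -
    from x consider a where "x = Wheel [a]" | "x = minimal_filter w" | "x \<in> set (pair_wheels (w + 1) t)"
      by (auto simp: split_cycle_def singles_def)
    then show ?thesis
    proof cases
      case 1
      then show ?thesis using w(1) by (simp add: largest_def)
    next
      case 2
      have "sorted_wrt (\<lambda>u v. largest u < largest v) (map (\<lambda>i. [i]) [1..<w + 2])"
        by (simp add: sorted_wrt_map largest_def del: upt_Suc)
      then show ?thesis
        using comp_allowed_minimal_filter[OF w(1)] unfolding 2
        by (auto simp: minimal_filter_def largest_def simp del: upt_Suc)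
    next
      case 3
      then obtain a where a: "x = Wheel [Suc a, a]" by (rule pair_wheelsE)
      have "w \<ge> 2" using 3 w(2) by auto
      then show ?thesis using a by (simp add: largest_def)
    qed
  qed
  moreover have "\<forall>i. Suc i < length (split_cycle n w t S) \<longrightarrow>
      adjacent_ok (split_cycle n w t S ! i) (split_cycle n w t S ! Suc i)"
    using successively_split_cycle[OF S] by (simp add: successively_conv_nth)
  ultimately have "basic_cycle n w (split_cycle n w t S)"
    unfolding basic_cycle_def concat_comp_wheels using w(1) by blast
  moreover have "cycle_dim (split_cycle n w t S) = w - 1 + t"
    by (simp add: split_cycle_def comp_dim_minimal_filter)
  ultimately show ?thesis by (simp add: basic_cycles_def)
qed

text \<open>The set S can be read off as the labels in front of the only filter.\<close>

lemma inj_split_cycle: "inj_on (split_cycle n w t) {S. finite S}"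
proof (rule inj_onI)
  let ?is_wheel = "\<lambda>x. case x of Wheel v \<Rightarrow> True | Filter ws \<Rightarrow> False"
  have prefix: "takeWhile ?is_wheel (split_cycle n w t S) = singles (descending S)" for S
    unfolding split_cycle_def
    by (subst takeWhile_append2) (auto simp: singles_def minimal_filter_def)
  fix S T assume "S \<in> {S. finite S}" "T \<in> {S. finite S}" "split_cycle n w t S = split_cycle n w t T"
  then show "S = T"
    using prefix[of S] prefix[of T] cycle_labels_singles set_descending by (metis mem_Collect_eq)
qed

lemma card_basic_cycles_ge:
  assumes "w \<ge> 1" "w \<ge> 2 \<or> j = 0" "w \<le> j + 1" and n: "w + 1 + 2 * (j + 1 - w) \<le> n"
  shows "2 ^ (n - (w + 1 + 2 * (j + 1 - w))) \<le> card (basic_cycles n w j)"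
proof -
  \<comment> \<open>The filter contributes dimension w - 1 and each wheel on two disks contributes
    1.\<close>
  let ?t = "j + 1 - w"
  let ?U = "{w + 2 + 2 * ?t..n}"
  have t: "w \<ge> 2 \<or> ?t = 0" "w - 1 + ?t = j" using assms(1-3) by auto
  have "card ?U = n - (w + 1 + 2 * ?t)" using n by simp
  then have "2 ^ (n - (w + 1 + 2 * ?t)) = card (Pow ?U)" by (simp add: card_Pow)
  also have "\<dots> = card (split_cycle n w ?t ` Pow ?U)"
    by (rule card_image[symmetric], rule inj_on_subset[OF inj_split_cycle]) (auto intro: finite_subset)
  also have "\<dots> \<le> card (basic_cycles n w j)"
    using split_cycle_basic[OF assms(1) t(1) n] unfolding t(2)
    by (intro card_mono finite_basic_cycles) auto
  finally show ?thesis .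
qed

text \<open>At width 1 all wheels are single disks, and a filter on k disks needs two wheels with at
  least k - 1 disks each, so k is at most 2 and its dimension is 0.\<close>

lemma basic_cycles_width_one:
  assumes "j > 0"
  shows "basic_cycles n 1 j = {}"
proof -
  have dim: "comp_dim x = 0" if "comp_allowed 1 x" for x
  proof (cases x rule: component.exhaust)
    case (Filter ws)
    have "\<exists>u v ws'. ws = u # v # ws'" using that Filter by (cases ws; cases "tl ws") auto
    then obtain u v ws' where ws: "ws = u # v # ws'" by blast
    have "length (concat ws) - 1 \<le> length u" "length (concat ws) - 1 \<le> length v"
      using that unfolding Filter ws by simp_all
    moreover have "length u + length v \<le> length (concat ws)" unfolding ws by simp
    ultimately show ?thesis using Filter by simp
  qed (use that in auto)
  have "cycle_dim c = 0" if "\<forall>x\<in>set c. comp_allowed 1 x" for c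
    using that by (induction c) (simp_all add: dim)
  then show ?thesis using assms basic_cycleD(4) by (fastforce simp: basic_cycles_def)
qed

lemma fraction_without_minimal_filters_tendsto_0:
  assumes w: "w \<ge> 1" "w \<le> j + 1"
    and A: "\<And>n. A n \<subseteq> without_minimal_filters n w j"
  shows "(\<lambda>n. real (card (A n)) / real (card (basic_cycles n w j))) \<longlonglongrightarrow> 0"
proof (cases "w \<ge> 2 \<or> j = 0")
  case False
  then have "w = 1" "j > 0" using w by auto
  then have "basic_cycles n w j = {}" for n
    using basic_cycles_width_one[of j n] by simp
  \<comment> \<open>The fraction is 0 / 0, which is 0 in HOL.\<close>
  then show ?thesis by simp
next
  case True
  define C where "C = w + 1 + 2 * (j + 1 - w)"
  define M where "M = (Suc (j + 2) * (j + 2) + 2) * j"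
  have "real (card (A n)) / real (card (basic_cycles n w j)) \<le> real (n + 2) ^ M * 2 ^ C / 2 ^ n" if n: "n \<ge> C" for n
  proof -
    have "finite (without_minimal_filters n w j)"
      using finite_basic_cycles by (rule rev_finite_subset) (auto simp: without_minimal_filters_def)
    then have "card (A n) \<le> (n + 2) ^ M"
      using card_mono[OF _ A] card_without_minimal_filters_le[of n w j] unfolding M_def by (blast intro: order_trans)
    then have num: "real (card (A n)) \<le> real (n + 2) ^ M"
      by (metis of_nat_le_iff of_nat_power)
    have "2 ^ (n - C) \<le> card (basic_cycles n w j)"
      using card_basic_cycles_ge[OF w(1) True w(2)] n unfolding C_def .
    then have den: "2 ^ (n - C) \<le> real (card (basic_cycles n w j))"
      by (metis of_nat_le_iff of_nat_numeral of_nat_power)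
    have "real (card (A n)) / real (card (basic_cycles n w j)) \<le> real (n + 2) ^ M / 2 ^ (n - C)"
      using num den by (intro frac_le) simp_all
    also have "\<dots> = real (n + 2) ^ M * 2 ^ C / 2 ^ n"
      using n by (simp add: power_diff)
    finally show ?thesis .
  qed
  then have "\<forall>\<^sub>F n in sequentially. real (card (A n)) / real (card (basic_cycles n w j)) \<le> real (n + 2) ^ M * 2 ^ C / 2 ^ n"
    using eventually_sequentially by blast
  \<comment> \<open>The constants \<open>M\<close> and \<open>C\<close> depend on j and w only, so a
    fixed polynomial is compared with an exponential.\<close>
  moreover have "(\<lambda>n. real (n + 2) ^ M * 2 ^ C / 2 ^ n) \<longlonglongrightarrow> 0"
    by real_asymp
  ultimately show ?thesis
    by (rule tendsto_sandwich[OF _ _ tendsto_const, rotated]) simp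
qed

section \<open>The dichotomy for persistence\<close>

theorem theorem7p4:
  fixes \<Phi> :: identification
  assumes "cellular_identification \<Phi>"
  shows
    "(\<forall>n c w\<^sub>0. born_at n c w\<^sub>0 \<longrightarrow>
        (\<forall>w>w\<^sub>0. persists \<Phi> n c w\<^sub>0 w) \<or> (\<exists>d\<le>2 * w\<^sub>0. dies_at \<Phi> n c d)) \<and>
     (\<forall>j w\<^sub>0. w\<^sub>0 \<ge> 1 \<longrightarrow>
        (\<forall>w>w\<^sub>0. \<forall>n. stab n w\<^sub>0 w j \<in> iso (config_homology n w\<^sub>0 j) (config_homology n w j)) \<or>
        (\<lambda>n. real (card {c \<in> basic_cycles n w\<^sub>0 j. persists \<Phi> n c w\<^sub>0 (w\<^sub>0 + 1)}) /
             real (card (basic_cycles n w\<^sub>0 j))) \<longlonglongrightarrow> 0)"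
proof (intro conjI allI impI)
  fix n c w\<^sub>0
  assume "born_at n c w\<^sub>0"
  then show "(\<forall>w>w\<^sub>0. persists \<Phi> n c w\<^sub>0 w) \<or> (\<exists>d\<le>2 * w\<^sub>0. dies_at \<Phi> n c d)"
    by (rule born_persists_or_dies[OF assms])
next
  fix j w\<^sub>0 :: nat
  assume w: "w\<^sub>0 \<ge> 1"
  show "(\<forall>w>w\<^sub>0. \<forall>n. stab n w\<^sub>0 w j \<in> iso (config_homology n w\<^sub>0 j) (config_homology n w j)) \<or>
      (\<lambda>n. real (card {c \<in> basic_cycles n w\<^sub>0 j. persists \<Phi> n c w\<^sub>0 (w\<^sub>0 + 1)}) /
           real (card (basic_cycles n w\<^sub>0 j))) \<longlonglongrightarrow> 0"
  proof (cases "j + 2 \<le> w\<^sub>0")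
    case True
    then show ?thesis using stab_iso[OF assms True] by simp
  next
    case False
    \<comment> \<open>A filter on one disk more than the width is already a boundary at the next
      width.\<close>
    have "{c \<in> basic_cycles n w\<^sub>0 j. persists \<Phi> n c w\<^sub>0 (w\<^sub>0 + 1)} \<subseteq> without_minimal_filters n w\<^sub>0 j" for n
      using filter_not_persists[OF assms, of n w\<^sub>0 _ "w\<^sub>0 + 1"]
      by (auto simp: without_minimal_filters_def basic_cycles_def)
    then have "(\<lambda>n. real (card {c \<in> basic_cycles n w\<^sub>0 j. persists \<Phi> n c w\<^sub>0 (w\<^sub>0 + 1)}) /
        real (card (basic_cycles n w\<^sub>0 j))) \<longlonglongrightarrow> 0"
      using w False by (intro fraction_without_minimal_filters_tendsto_0) simp_all
    then show ?thesis ..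
  qed
qed

end
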